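(* Let $N\ge1$ and define $q$-difference operators $\widehat D^1_N(q,t),\dots,\widehat D^N_N(q,t)$ in the variables $u_1,\dots,u_N$ by the expansion in powers of the formal variable $z$ $$ \frac1{V(u_1,\dots,u_N)}\det\Big[u_j^{-1}\big\{(u_j-1)u_j^{N-i}t^{i-N}z\,T^{-1}_{q,u_j}+(u_j+z)u_j^{N-i}\big\}\Big]_{i,j=1}^N=1+\sum_{r=1}^N\widehat D^r_N(q,t)\,z^r . $$ Then the operators $\widehat D^1_N(q,t),\dots,\widehat D^N_N(q,t)$ commute with each other.
   Context: $q,t$ are formal variables and $\mathbb F=\mathbb Q(q,t)$. $V(u_1,\dots,u_N)=\prod_{1\le i<j\le N}(u_i-u_j)$. $T^{-1}_{q,u}$ is the inverse $q$-shift operator: $(T^{-1}_{q,u}f)(u)=f(uq^{-1})$. The operators are $q$-difference operators with coefficients rational functions of $u_1,\dots,u_N$ over $\mathbb F$ (acting for instance on $\mathbb F(u_1,\dots,u_N)$). In the determinant the entries in different columns commute (column $j$ involves only $u_j$ and its shift); within an entry the multiplication operators stand to the left of $T^{-1}_{q,u_j}$. *)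

theory Defs
  imports
    "HOL-Library.Poly_Mapping"
    "HOL-Computational_Algebra.Polynomial"
    "HOL-Computational_Algebra.Fraction_Field"
    "HOL-Combinatorics.Permutations"
begin

text \<open>
  The base field \<open>\<rat>(q,t)\<close>, as the fraction field of \<open>\<rat>[q][t]\<close>: the variable of the inner
  polynomial ring is \<open>q\<close>, that of the outer one is \<open>t\<close>.
\<close>

type_synonym qt_field = "rat poly poly fract"

definition qq :: qt_field where
  "qq = Fraction_Field.Fract [:[:0, 1:]:] 1"

definition tt :: qt_field where
  "tt = Fraction_Field.Fract [:0, 1:] 1"

text \<open>
  Polynomials, and their fraction field, in countably many variables \<open>u\<^sub>0, u\<^sub>1, u\<^sub>2, \<dots>\<close> over
  \<open>\<rat>(q,t)\<close>.  A monomial is a finitely supported exponent function \<open>nat \<Rightarrow>\<^sub>0 nat\<close>.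
  The operators below for a given \<open>N\<close> involve only \<open>u\<^sub>1, \<dots>, u\<^sub>N\<close> and the corresponding shifts;
  the remaining variables are spectators, so the operators restrict to \<open>\<rat>(q,t)(u\<^sub>1, \<dots>, u\<^sub>N)\<close>.
\<close>

type_synonym upoly = "(nat \<Rightarrow>\<^sub>0 nat) \<Rightarrow>\<^sub>0 qt_field"
type_synonym ufield = "upoly fract"

definition base_const :: "qt_field \<Rightarrow> ufield" where
  "base_const c = Fraction_Field.Fract (Poly_Mapping.single 0 c) 1"

definition uvar :: "nat \<Rightarrow> ufield" where
  "uvar j = Fraction_Field.Fract (Poly_Mapping.single (Poly_Mapping.single j 1) 1) 1"

text \<open>The substitution \<open>u\<^sub>j \<mapsto> u\<^sub>j q\<^sup>-\<^sup>1\<close> multiplies the monomial \<open>u\<^sup>m\<close> by \<open>q\<close> to the power \<open>- m\<^sub>j\<close>.\<close>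

lift_definition q_shift_poly :: "nat \<Rightarrow> upoly \<Rightarrow> upoly"
  is "\<lambda>j p m. p m * inverse qq ^ Poly_Mapping.lookup m j"
  by (rule finite_subset) auto

lemma qq_nonzero [simp]: "qq \<noteq> 0"
  by (simp add: qq_def Zero_fract_def eq_fract)

lemma q_shift_poly_zero [simp]: "q_shift_poly j 0 = 0"
  by transfer simp

lemma q_shift_poly_add: "q_shift_poly j (a + b) = q_shift_poly j a + q_shift_poly j b"
  by transfer (simp add: fun_eq_iff algebra_simps)

lemma q_shift_poly_single:
  "q_shift_poly j (Poly_Mapping.single m c) =
     Poly_Mapping.single m (c * inverse qq ^ Poly_Mapping.lookup m j)"
  by (rule poly_mapping_eqI) (simp add: q_shift_poly.rep_eq lookup_single when_def)

lemma q_shift_poly_eq_0_iff [simp]: "q_shift_poly j a = 0 \<longleftrightarrow> a = 0"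
  by (simp add: poly_mapping_eq_iff fun_eq_iff q_shift_poly.rep_eq)

lemma q_shift_poly_mult: "q_shift_poly j (a * b) = q_shift_poly j a * q_shift_poly j b"
proof (induction a rule: update_induct)
  case const
  show ?case by simp
next
  case (update a m c)
  have eq: "Poly_Mapping.update m c a = a + Poly_Mapping.single m c"
    using update(1) by (intro poly_mapping_eqI)
      (auto simp: lookup_update lookup_add lookup_single when_def in_keys_iff)
  have "q_shift_poly j (Poly_Mapping.single m c * b) =
          q_shift_poly j (Poly_Mapping.single m c) * q_shift_poly j b"
  proof (induction b rule: update_induct)
    case const
    show ?case by simp
  next
    case (update b m' c')
    have "Poly_Mapping.update m' c' b = b + Poly_Mapping.single m' c'"
      using update(1) by (intro poly_mapping_eqI)
        (auto simp: lookup_update lookup_add lookup_single when_def in_keys_iff)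
    then show ?case
      using update(3)
      by (simp add: distrib_left q_shift_poly_add mult_single q_shift_poly_single
          lookup_add power_add mult_ac)
  qed
  then show ?case
    using update(3) by (simp add: eq distrib_right q_shift_poly_add)
qed

text \<open>The inverse \<open>q\<close>-shift operator \<open>T\<^sup>-\<^sup>1\<close> in the variable \<open>u\<^sub>j\<close>.\<close>

lift_definition q_shift_inv :: "nat \<Rightarrow> ufield \<Rightarrow> ufield"
  is "\<lambda>j (a, b). (q_shift_poly j a, q_shift_poly j b)"
  by (auto simp flip: q_shift_poly_mult)

lemma q_shift_inv_Fract:
  "b \<noteq> 0 \<Longrightarrow> q_shift_inv j (Fraction_Field.Fract a b) =
     Fraction_Field.Fract (q_shift_poly j a) (q_shift_poly j b)"
  by (simp add: Fract.abs_eq q_shift_inv.abs_eq eq_onp_def)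

lemma q_shift_poly_one [simp]: "q_shift_poly j 1 = 1"
  using q_shift_poly_single[of j 0 1] by simp

lemma q_shift_inv_zero [simp]: "q_shift_inv j 0 = 0"
  by (simp add: Zero_fract_def q_shift_inv_Fract)

lemma q_shift_inv_add: "q_shift_inv j (x + y) = q_shift_inv j x + q_shift_inv j y"
proof -
  obtain a b where x: "x = Fraction_Field.Fract a b" "b \<noteq> 0" by (rule Fract_cases)
  obtain c d where y: "y = Fraction_Field.Fract c d" "d \<noteq> 0" by (rule Fract_cases)
  have bd: "b * d \<noteq> 0" using x(2) y(2) by (rule no_zero_divisors)
  have b': "q_shift_poly j b \<noteq> 0" and d': "q_shift_poly j d \<noteq> 0"
    unfolding q_shift_poly_eq_0_iff by (fact x(2), fact y(2))
  show ?thesis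
    unfolding x(1) y(1) add_fract[OF x(2) y(2)] q_shift_inv_Fract[OF bd]
      q_shift_inv_Fract[OF x(2)] q_shift_inv_Fract[OF y(2)] add_fract[OF b' d']
      q_shift_poly_add q_shift_poly_mult ..
qed

lemma q_shift_inv_mult: "q_shift_inv j (x * y) = q_shift_inv j x * q_shift_inv j y"
proof -
  obtain a b where x: "x = Fraction_Field.Fract a b" "b \<noteq> 0" by (rule Fract_cases)
  obtain c d where y: "y = Fraction_Field.Fract c d" "d \<noteq> 0" by (rule Fract_cases)
  have bd: "b * d \<noteq> 0" using x(2) y(2) by (rule no_zero_divisors)
  show ?thesis
    unfolding x(1) y(1) mult_fract q_shift_inv_Fract[OF bd]
      q_shift_inv_Fract[OF x(2)] q_shift_inv_Fract[OF y(2)] q_shift_poly_mult ..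
qed

lemma q_shift_inv_base_const: "q_shift_inv j (base_const c) = base_const c"
  by (simp add: base_const_def q_shift_inv_Fract q_shift_poly_single)

lemma q_shift_inv_uvar: "q_shift_inv j (uvar i) =
     (if i = j then uvar i * base_const (inverse qq) else uvar i)"
  by (auto simp: uvar_def base_const_def q_shift_inv_Fract q_shift_poly_single lookup_single mult_single)

definition vandermonde :: "nat \<Rightarrow> ufield" where
  "vandermonde N = (\<Prod>i = 1..N. \<Prod>j = Suc i..N. uvar i - uvar j)"

text \<open>
  Operators with coefficients in \<open>\<rat>(q,t)(u)[z]\<close> are realised as maps on \<open>ufield poly\<close>, the
  polynomials in \<open>z\<close>; the shift acts on such a polynomial coefficientwise.
\<close>

definition zz :: "ufield poly" where
  "zz = [:0, 1:]"

definition det_entry :: "nat \<Rightarrow> nat \<Rightarrow> nat \<Rightarrow> ufield poly \<Rightarrow> ufield poly" where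
  "det_entry N i j g =
     [:inverse (uvar j):] *
       ([:(uvar j - 1) * uvar j ^ (N - i) * base_const (tt powi (int i - int N)):] * zz
           * map_poly (q_shift_inv j) g
        + ([:uvar j:] + zz) * [:uvar j ^ (N - i):] * g)"

text \<open>
  The determinant of an \<open>N \<times> N\<close> matrix of operators whose entries in different columns commute:
  products are compositions, ordered here by increasing column index.
\<close>

definition operator_det ::
  "nat \<Rightarrow> (nat \<Rightarrow> nat \<Rightarrow> 'a \<Rightarrow> 'a) \<Rightarrow> 'a \<Rightarrow> 'a::ring_1" where
  "operator_det N A g =
     (\<Sum>\<sigma> | \<sigma> permutes {1..N}.
        of_int (sign \<sigma>) * foldr (\<lambda>j. A (\<sigma> j) j) [1..<Suc N] g)"

definition generating_operator :: "nat \<Rightarrow> ufield poly \<Rightarrow> ufield poly" where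
  "generating_operator N g = [:inverse (vandermonde N):] * operator_det N (det_entry N) g"

text \<open>The coefficient of \<open>z\<^sup>r\<close>, as an operator on functions not depending on \<open>z\<close>.\<close>

definition D_hat :: "nat \<Rightarrow> nat \<Rightarrow> ufield \<Rightarrow> ufield" where
  "D_hat N r f = coeff (generating_operator N [:f:]) r"

end

theory Submission
  imports Defs
begin

text \<open>
  Expanding the determinant by the set \<open>I\<close> of shifted columns writes the generating operator as
  \<open>D(z) = \<Sum>\<^sub>I A\<^sub>I(z) T\<^sub>I\<close>, where \<open>A\<^sub>I\<close> contains a ratio of two Vandermonde products.  In
  \<open>D(z) D(w)\<close> the coefficient of \<open>T\<^sub>K\<^sup>2 T\<^sub>L\<close> is a factor symmetric in \<open>z, w\<close> times a sum over the
  splittings \<open>L = I \<union> J\<close>.  The symmetry of this sum follows by induction on \<open>L\<close>: as a rational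
  function of one variable \<open>u\<^sub>n\<close>, its antisymmetrisation in \<open>z, w\<close> has no pole, since the residues
  at \<open>u\<^sub>n = u\<^sub>k\<close> cancel and those at \<open>u\<^sub>n = q u\<^sub>k\<close> and \<open>u\<^sub>n = u\<^sub>k / q\<close> are symmetric by induction.
  It is therefore affine in \<open>u\<^sub>n\<close>, and it vanishes because its value at \<open>0\<close> and its leading
  coefficient are again governed by a smaller set.  The parameters \<open>z, w\<close> are specialised to
  elements of \<open>\<rat>(q,t)\<close>, an infinite field fixed by all shifts, and the coefficients of the powers
  of \<open>z\<close> and \<open>w\<close> are recovered at the end.
\<close>

subsection \<open>The exchange identity\<close>

lemma sum_Pow_insert:
  assumes "finite L" "n \<notin> L"
  shows "(\<Sum>I\<in>Pow (insert n L). F I) = (\<Sum>I\<in>Pow L. F I + F (insert n I))"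
proof -
  have inj: "inj_on (insert n) (Pow L)"
    using assms by (auto simp: inj_on_def)
  have "(\<Sum>I\<in>Pow (insert n L). F I) = sum F (Pow L) + sum F (insert n ` Pow L)"
    unfolding Pow_insert using assms by (intro sum.union_disjoint) auto
  also have "sum F (insert n ` Pow L) = (\<Sum>I\<in>Pow L. F (insert n I))"
    by (simp add: sum.reindex[OF inj])
  finally show ?thesis by (simp add: sum.distrib)
qed

lemma coeff_mult_top:
  fixes p r :: "'a::comm_semiring_0 poly"
  assumes "degree p \<le> m" "degree r \<le> n"
  shows "coeff (p * r) (m + n) = coeff p m * coeff r n"
proof -
  have "coeff (p * r) (m + n) = (\<Sum>i\<le>m + n. coeff p i * coeff r (m + n - i))"
    by (simp add: coeff_mult)
  also have "\<dots> = (\<Sum>i\<le>m + n. if i = m then coeff p m * coeff r n else 0)"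
    using assms by (intro sum.cong) (auto simp: coeff_eq_0 not_less_iff_gr_or_eq nat_neq_iff)
  finally show ?thesis by simp
qed

lemma degree_prod_le_const:
  fixes p :: "'b \<Rightarrow> 'a::comm_semiring_1 poly"
  assumes "finite S" "\<And>i. i \<in> S \<Longrightarrow> degree (p i) \<le> d"
  shows "degree (\<Prod>i\<in>S. p i) \<le> d * card S"
  using assms(1)
    sum_bounded_above[of S "degree \<circ> p" d] degree_prod_sum_le[of S p] assms(2)
  by (force simp: mult.commute)

lemma coeff_prod_top:
  fixes p :: "'b \<Rightarrow> 'a::comm_semiring_1 poly"
  assumes "finite S" "\<And>i. i \<in> S \<Longrightarrow> degree (p i) \<le> d"
  shows "coeff (\<Prod>i\<in>S. p i) (d * card S) = (\<Prod>i\<in>S. coeff (p i) d)"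
  using assms
proof (induction S)
  case (insert a S)
  then show ?case
    using coeff_mult_top[of "p a" d "prod p S" "d * card S"] degree_prod_le_const[of S p d]
    by simp
qed simp

text \<open>The conditions keep the denominators of \<open>phi\<close> nonzero at distinct points
  and make the interpolation nodes \<open>0\<close>, \<open>x k\<close>, \<open>q * x k\<close> and
  \<open>x k / q\<close> pairwise distinct.\<close>

locale generic_points =
  fixes q t :: "'a::field" and x :: "nat \<Rightarrow> 'a"
  assumes q0: "q \<noteq> 0" and q1: "q \<noteq> 1" and qq1: "q * q \<noteq> 1" and t0: "t \<noteq> 0"
    and x0: "x i \<noteq> 0"
    and x_ne: "i \<noteq> j \<Longrightarrow> x i \<noteq> x j"
    and x_ne_q: "i \<noteq> j \<Longrightarrow> x i \<noteq> q * x j"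
    and x_ne_qq: "i \<noteq> j \<Longrightarrow> x i \<noteq> q * q * x j"
begin

text \<open>The Vandermonde factors of a pair when \<open>a\<close> is shifted by the first operator
  and \<open>b\<close> by the second, divided by their value \<open>1 / t\<close> when both are
  shifted by the first.\<close>

definition phi :: "'a \<Rightarrow> 'a \<Rightarrow> 'a" where
  "phi a b = (a - t * b) * (t * a - q * b) / (t * (a - b) * (a - q * b))"

text \<open>
  The part depending on \<open>I\<close> of the contribution of the shifts \<open>T\<^sub>I\<close> (spectral parameter \<open>z\<close>) and
  \<open>T\<^bsub>L - I\<^esub>\<close> (spectral parameter \<open>w\<close>) to the coefficient of \<open>T\<^sub>L\<close> in the product of two
  generating operators, up to a factor depending only on \<open>L\<close>.
\<close>

definition weight :: "'a \<Rightarrow> 'a \<Rightarrow> nat set \<Rightarrow> nat set \<Rightarrow> 'a" where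
  "weight z w L I = (\<Prod>i\<in>I. z * (x i + q * w)) * (\<Prod>j\<in>L - I. w * (x j + z)) *
     (\<Prod>i\<in>I. \<Prod>j\<in>L - I. phi (x i) (x j))"

definition cross_sum :: "'a \<Rightarrow> 'a \<Rightarrow> nat set \<Rightarrow> 'a" where
  "cross_sum z w L = (\<Sum>I\<in>Pow L. weight z w L I)"

lemma weight_insert_right:
  assumes "finite L" "n \<notin> L" "I \<subseteq> L"
  shows "weight z w (insert n L) I =
    weight z w L I * (w * (x n + z) * (\<Prod>i\<in>I. phi (x i) (x n)))"
proof -
  have "insert n L - I = insert n (L - I)" "n \<notin> L - I" "finite (L - I)"
    using assms by auto
  then show ?thesis by (simp add: weight_def prod.distrib mult_ac)
qed

lemma weight_insert_left:
  assumes "finite L" "n \<notin> L" "I \<subseteq> L"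
  shows "weight z w (insert n L) (insert n I) =
    weight z w L I * (z * (x n + q * w) * (\<Prod>j\<in>L - I. phi (x n) (x j)))"
proof -
  have "insert n L - insert n I = L - I" "n \<notin> I" "finite I"
    using assms finite_subset by auto
  then show ?thesis by (simp add: weight_def prod.distrib mult_ac)
qed

text \<open>
  \<open>cden a\<close> clears the denominators of both \<open>phi a X\<close> and \<open>phi X a\<close>, which have their poles at
  \<open>X = a\<close>, \<open>X = q a\<close> and \<open>X = a / q\<close>; \<open>cleft a\<close> and \<open>cright a\<close> are the resulting numerators.
\<close>

definition cden :: "'a \<Rightarrow> 'a poly" where
  "cden a = [:- a, 1:] * [:- q * a, 1:] * [:a, - q:]"

definition cleft :: "'a \<Rightarrow> 'a poly" where
  "cleft a = smult (- 1 / t) ([:a, - t:] * [:t * a, - q:] * [:- q * a, 1:])"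

definition cright :: "'a \<Rightarrow> 'a poly" where
  "cright a = smult (1 / t) ([:- t * a, 1:] * [:- q * a, t:] * [:a, - q:])"

lemma poly_cden: "poly (cden a) y = (y - a) * (y - q * a) * (a - q * y)"
  unfolding cden_def poly_mult by simp

lemma poly_cleft: "poly (cleft a) y = - ((a - t * y) * (t * a - q * y) * (y - q * a)) / t"
  unfolding cleft_def poly_smult poly_mult by (simp add: mult_ac)

lemma poly_cright: "poly (cright a) y = (y - t * a) * (t * y - q * a) * (a - q * y) / t"
  unfolding cright_def poly_smult poly_mult by (simp add: mult_ac)

lemma points_ne:
  assumes "i \<noteq> k"
  shows "x i \<noteq> x k" "x k \<noteq> x i" "x i \<noteq> q * x k" "x k \<noteq> q * x i"
  using assms x_ne[of i k] x_ne_q[of i k] x_ne_q[of k i] by metis+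

lemma cleft_eq: "a \<noteq> y \<Longrightarrow> a \<noteq> q * y \<Longrightarrow> poly (cleft a) y = phi a y * poly (cden a) y"
  using t0 by (simp add: poly_cleft poly_cden phi_def divide_simps) (simp add: algebra_simps)

lemma cright_eq: "y \<noteq> a \<Longrightarrow> y \<noteq> q * a \<Longrightarrow> poly (cright a) y = phi y a * poly (cden a) y"
  using t0 by (simp add: poly_cright poly_cden phi_def divide_simps)

text \<open>This crossing symmetry makes the residues at \<open>q * x k\<close> and
  \<open>x k / q\<close> independent of the splitting.\<close>

lemma phi_shift: "phi (q * b) a = phi a b"
proof (cases "a = b \<or> a = q * b")
  \<comment> \<open>At a pole both sides are 0, since division by zero yields 0.\<close>
  case True
  then show ?thesis by (auto simp: phi_def)
next
  case False
  then have "b - a \<noteq> 0" "a - b \<noteq> 0" "q * b - a \<noteq> 0" "a - q * b \<noteq> 0" by auto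
  then show ?thesis
    using t0 q0 unfolding phi_def by (simp add: divide_simps) (simp add: algebra_simps)
qed

lemma degree_cubic: "degree (cden a) \<le> 3" "degree (cleft a) \<le> 3" "degree (cright a) \<le> 3"
  by (auto simp: cden_def cleft_def cright_def)

text \<open>Equal leading coefficients, and below equal values at 0, express that \<open>phi\<close>
  tends to 1 at infinity and at 0 in either argument. Hence there the new variable decouples from
  the splitting of the others.\<close>

lemma coeff_cubic: "coeff (cden a) 3 = - q" "coeff (cleft a) 3 = - q" "coeff (cright a) 3 = - q"
  using t0 by (simp_all add: cden_def cleft_def cright_def numeral_3_eq_3)

lemma poly_cubic_0: "poly (cden a) 0 = q * a ^ 3" "poly (cleft a) 0 = q * a ^ 3"
    "poly (cright a) 0 = q * a ^ 3"
  using t0 by (simp_all add: poly_cden poly_cleft poly_cright power3_eq_cube)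

text \<open>The first term has the new variable on the \<open>w\<close> side of the splitting, the
  second on the \<open>z\<close> side.\<close>

definition summand :: "'a \<Rightarrow> 'a \<Rightarrow> nat set \<Rightarrow> nat set \<Rightarrow> 'a poly" where
  "summand z w L I =
     [:w * z, w:] * ((\<Prod>i\<in>I. cleft (x i)) * (\<Prod>j\<in>L - I. cden (x j))) +
     [:z * q * w, z:] * ((\<Prod>i\<in>I. cden (x i)) * (\<Prod>j\<in>L - I. cright (x j)))"

text \<open>
  For \<open>n \<notin> L\<close>, the value at \<open>x n\<close> of \<open>interp z w L\<close> is \<open>cross_sum z w (insert n L)\<close> with its
  denominators cleared: only \<open>x n\<close> has been replaced by an indeterminate.
\<close>

definition interp :: "'a \<Rightarrow> 'a \<Rightarrow> nat set \<Rightarrow> 'a poly" where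
  "interp z w L = (\<Sum>I\<in>Pow L. smult (weight z w L I) (summand z w L I))"

abbreviation lprod :: "nat set \<Rightarrow> nat set \<Rightarrow> 'a \<Rightarrow> 'a" where
  "lprod L I y \<equiv> (\<Prod>i\<in>I. poly (cleft (x i)) y) * (\<Prod>j\<in>L - I. poly (cden (x j)) y)"

abbreviation rprod :: "nat set \<Rightarrow> nat set \<Rightarrow> 'a \<Rightarrow> 'a" where
  "rprod L I y \<equiv> (\<Prod>i\<in>I. poly (cden (x i)) y) * (\<Prod>j\<in>L - I. poly (cright (x j)) y)"

lemma poly_summand:
  "poly (summand z w L I) y =
     w * (y + z) * lprod L I y +
     z * (y + q * w) * rprod L I y"
  by (simp add: summand_def poly_prod algebra_simps)

lemma poly_interp:
  "poly (interp z w L) y = (\<Sum>I\<in>Pow L. weight z w L I * poly (summand z w L I) y)"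
  by (simp add: interp_def poly_sum)

lemma prod_split:
  fixes g :: "nat \<Rightarrow> 'b::comm_monoid_mult"
  assumes "finite L" "I \<subseteq> L"
  shows "(\<Prod>i\<in>L. g i) = (\<Prod>i\<in>I. g i) * (\<Prod>j\<in>L - I. g j)"
  using prod.subset_diff[OF assms(2,1), of g] by (simp add: mult.commute)

lemma interp_at_new_point:
  assumes "finite L" "n \<notin> L"
  shows "poly (interp z w L) (x n) =
    cross_sum z w (insert n L) * (\<Prod>j\<in>L. poly (cden (x j)) (x n))"
proof -
  have "weight z w L I * poly (summand z w L I) (x n) =
      (weight z w (insert n L) I + weight z w (insert n L) (insert n I)) *
      (\<Prod>j\<in>L. poly (cden (x j)) (x n))" if "I \<in> Pow L" for I
  proof -
    have I: "I \<subseteq> L" using that by simp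
    have ne: "x i \<noteq> x n" "x n \<noteq> x i" "x i \<noteq> q * x n" "x n \<noteq> q * x i" if "i \<in> L" for i
      using points_ne[of i n] that assms(2) by metis+
    have l: "(\<Prod>i\<in>I. poly (cleft (x i)) (x n)) =
        (\<Prod>i\<in>I. phi (x i) (x n)) * (\<Prod>i\<in>I. poly (cden (x i)) (x n))"
      unfolding prod.distrib[symmetric] using I ne by (intro prod.cong refl) (auto simp: cleft_eq subset_iff)
    have r: "(\<Prod>i\<in>L - I. poly (cright (x i)) (x n)) =
        (\<Prod>i\<in>L - I. phi (x n) (x i)) * (\<Prod>i\<in>L - I. poly (cden (x i)) (x n))"
      unfolding prod.distrib[symmetric] using ne by (intro prod.cong refl) (auto simp: cright_eq)
    show ?thesis
      unfolding poly_summand l r weight_insert_left[OF assms I] weight_insert_right[OF assms I]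
        prod_split[OF assms(1) I]
      by (simp add: algebra_simps)
  qed
  then show ?thesis
    by (simp add: poly_interp cross_sum_def sum_Pow_insert[OF assms] sum_distrib_right)
qed

text \<open>Isolates the factors belonging to \<open>k\<close>: at each of \<open>x k\<close>,
  \<open>q * x k\<close> and \<open>x k / q\<close> the polynomial \<open>cden (x k)\<close>
  vanishes, so only splittings that separate \<open>k\<close> from the new variable survive.\<close>

lemma interp_insert:
  assumes "finite L" "k \<notin> L"
  shows "poly (interp z w (insert k L)) y =
    (\<Sum>I\<in>Pow L. weight z w L I *
      (w * (x k + z) * (\<Prod>i\<in>I. phi (x i) (x k)) *
         (w * (y + z) * (poly (cden (x k)) y * lprod L I y) +
          z * (y + q * w) * (poly (cright (x k)) y * rprod L I y)) +
       z * (x k + q * w) * (\<Prod>j\<in>L - I. phi (x k) (x j)) *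
         (w * (y + z) * (poly (cleft (x k)) y * lprod L I y) +
          z * (y + q * w) * (poly (cden (x k)) y * rprod L I y))))"
  unfolding poly_interp sum_Pow_insert[OF assms]
proof (intro sum.cong refl)
  fix I assume "I \<in> Pow L"
  then have I: "I \<subseteq> L" by simp
  have d: "insert k L - I = insert k (L - I)" "insert k L - insert k I = L - I"
    "k \<notin> L - I" "k \<notin> I" "finite (L - I)" "finite I"
    using assms I finite_subset by auto
  show "weight z w (insert k L) I * poly (summand z w (insert k L) I) y +
        weight z w (insert k L) (insert k I) * poly (summand z w (insert k L) (insert k I)) y =
      weight z w L I *
      (w * (x k + z) * (\<Prod>i\<in>I. phi (x i) (x k)) *
         (w * (y + z) * (poly (cden (x k)) y * lprod L I y) +
          z * (y + q * w) * (poly (cright (x k)) y * rprod L I y)) +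
       z * (x k + q * w) * (\<Prod>j\<in>L - I. phi (x k) (x j)) *
         (w * (y + z) * (poly (cleft (x k)) y * lprod L I y) +
          z * (y + q * w) * (poly (cden (x k)) y * rprod L I y)))"
    unfolding weight_insert_left[OF assms I] weight_insert_right[OF assms I] poly_summand
      d(1,2) prod.insert[OF d(5,3)] prod.insert[OF d(6,4)]
    by (simp add: distrib_left mult_ac)
qed

text \<open>The two ways of separating \<open>k\<close> from the new variable are exchanged when
  these two equal points are swapped, and the swap changes only the sign, because
  \<open>cleft\<close> and \<open>cright\<close> are opposite there.\<close>

lemma interp_at_point:
  assumes "finite L" "k \<notin> L"
  shows "poly (interp z w (insert k L)) (x k) = 0"
  unfolding interp_insert[OF assms]
proof (intro sum.neutral ballI)
  fix I assume "I \<in> Pow L"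
  then have I: "I \<subseteq> L" by simp
  have ne: "x i \<noteq> x k" "x k \<noteq> x i" "x i \<noteq> q * x k" "x k \<noteq> q * x i" if "i \<in> L" for i
    using points_ne[of i k] that assms(2) by metis+
  have l: "(\<Prod>i\<in>I. poly (cleft (x i)) (x k)) =
      (\<Prod>i\<in>I. phi (x i) (x k)) * (\<Prod>i\<in>I. poly (cden (x i)) (x k))"
    unfolding prod.distrib[symmetric] using I ne by (intro prod.cong refl) (auto simp: cleft_eq subset_iff)
  have r: "(\<Prod>i\<in>L - I. poly (cright (x i)) (x k)) =
      (\<Prod>i\<in>L - I. phi (x k) (x i)) * (\<Prod>i\<in>L - I. poly (cden (x i)) (x k))"
    unfolding prod.distrib[symmetric] using ne by (intro prod.cong refl) (auto simp: cright_eq)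
  have d: "poly (cden (x k)) (x k) = 0" by (simp add: poly_cden)
  have lr: "poly (cleft (x k)) (x k) = - poly (cright (x k)) (x k)"
    by (simp add: poly_cleft poly_cright)
  show "weight z w L I *
      (w * (x k + z) * (\<Prod>i\<in>I. phi (x i) (x k)) *
         (w * (x k + z) * (poly (cden (x k)) (x k) * lprod L I (x k)) +
          z * (x k + q * w) * (poly (cright (x k)) (x k) * rprod L I (x k))) +
       z * (x k + q * w) * (\<Prod>j\<in>L - I. phi (x k) (x j)) *
         (w * (x k + z) * (poly (cleft (x k)) (x k) * lprod L I (x k)) +
          z * (x k + q * w) * (poly (cden (x k)) (x k) * rprod L I (x k)))) = 0"
    unfolding l r d lr by (simp add: mult_ac)
qed

text \<open>Only the case of \<open>k\<close> on the \<open>w\<close> side and the new variable on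
  the \<open>z\<close> side survives. By \<open>phi_shift\<close> the factors linking these two to
  the rest do not depend on \<open>I\<close>, which leaves the smaller \<open>cross_sum\<close>
  times a prefactor symmetric in \<open>z\<close> and \<open>w\<close>.\<close>

lemma interp_at_q_point:
  assumes "finite L" "k \<notin> L"
  shows "poly (interp z w (insert k L)) (q * x k) =
    q * z * w * (x k + z) * (x k + w) * poly (cright (x k)) (q * x k) *
      (\<Prod>j\<in>L. poly (cright (x j)) (q * x k)) * cross_sum z w L"
  unfolding interp_insert[OF assms] cross_sum_def sum_distrib_left
proof (intro sum.cong refl)
  fix I assume "I \<in> Pow L"
  then have I: "I \<subseteq> L" by simp
  have ne: "q * x k \<noteq> x i" "q * x k \<noteq> q * x i" if "i \<in> L" for i
    using points_ne[of i k] that assms(2) q0 by (metis mult_cancel_left)+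
  have r: "(\<Prod>i\<in>I. phi (x i) (x k)) * (\<Prod>i\<in>I. poly (cden (x i)) (q * x k)) =
      (\<Prod>i\<in>I. poly (cright (x i)) (q * x k))"
    unfolding prod.distrib[symmetric] using I ne
    by (intro prod.cong refl) (auto simp: cright_eq subset_iff phi_shift)
  have d: "poly (cden (x k)) (q * x k) = 0" "poly (cleft (x k)) (q * x k) = 0"
    by (simp_all add: poly_cden poly_cleft)
  have e: "q * x k + q * w = q * (x k + w)" by (simp add: distrib_left)
  show "weight z w L I *
      (w * (x k + z) * (\<Prod>i\<in>I. phi (x i) (x k)) *
         (w * (q * x k + z) * (poly (cden (x k)) (q * x k) * lprod L I (q * x k)) +
          z * (q * x k + q * w) * (poly (cright (x k)) (q * x k) * rprod L I (q * x k))) +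
       z * (x k + q * w) * (\<Prod>j\<in>L - I. phi (x k) (x j)) *
         (w * (q * x k + z) * (poly (cleft (x k)) (q * x k) * lprod L I (q * x k)) +
          z * (q * x k + q * w) * (poly (cden (x k)) (q * x k) * rprod L I (q * x k)))) =
    q * z * w * (x k + z) * (x k + w) * poly (cright (x k)) (q * x k) *
      (\<Prod>j\<in>L. poly (cright (x j)) (q * x k)) * weight z w L I"
    unfolding d e prod_split[OF assms(1) I] r[symmetric] by (simp add: mult_ac)
qed

text \<open>The mirror case, with \<open>k\<close> on the \<open>z\<close> side and the new variable
  on the \<open>w\<close> side. Here \<open>y + z\<close> equals \<open>(x k + q * z) / q\<close>,
  which pairs with \<open>x k + q * w\<close> into a symmetric product.\<close>

lemma interp_at_point_div_q:
  assumes "finite L" "k \<notin> L"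
  shows "poly (interp z w (insert k L)) (x k / q) =
    z * w * (x k + q * z) * (x k + q * w) / q * poly (cleft (x k)) (x k / q) *
      (\<Prod>j\<in>L. poly (cleft (x j)) (x k / q)) * cross_sum z w L"
  unfolding interp_insert[OF assms] cross_sum_def sum_distrib_left
proof (intro sum.cong refl)
  fix I assume "I \<in> Pow L"
  then have I: "I \<subseteq> L" by simp
  define y where "y = x k / q"
  have xk: "x k = q * y" using q0 by (simp add: y_def)
  have ne: "x i \<noteq> y" "x i \<noteq> q * y" if "i \<in> L" for i
    using points_ne[of i k] that assms(2) q0 unfolding xk by (metis mult_cancel_left)+
  have l: "(\<Prod>i\<in>L - I. phi (x k) (x i)) * (\<Prod>i\<in>L - I. poly (cden (x i)) y) =
      (\<Prod>i\<in>L - I. poly (cleft (x i)) y)"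
    unfolding prod.distrib[symmetric] using ne
    by (intro prod.cong refl) (auto simp: cleft_eq subset_iff phi_shift xk)
  have d: "poly (cden (x k)) y = 0" "poly (cright (x k)) y = 0"
    by (simp_all add: poly_cden poly_cright xk)
  have e: "(x k + q * z) / q = y + z" using q0 by (simp add: y_def field_simps)
  have "weight z w L I *
      (w * (x k + z) * (\<Prod>i\<in>I. phi (x i) (x k)) *
         (w * (y + z) * (poly (cden (x k)) y * lprod L I y) +
          z * (y + q * w) * (poly (cright (x k)) y * rprod L I y)) +
       z * (x k + q * w) * (\<Prod>j\<in>L - I. phi (x k) (x j)) *
         (w * (y + z) * (poly (cleft (x k)) y * lprod L I y) +
          z * (y + q * w) * (poly (cden (x k)) y * rprod L I y))) =
    z * w * ((x k + q * z) / q) * (x k + q * w) * poly (cleft (x k)) y *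
      (\<Prod>j\<in>L. poly (cleft (x j)) y) * weight z w L I"
    unfolding d e prod_split[OF assms(1) I] l[symmetric] by (simp add: mult_ac)
  then show "weight z w L I *
      (w * (x k + z) * (\<Prod>i\<in>I. phi (x i) (x k)) *
         (w * (x k / q + z) * (poly (cden (x k)) (x k / q) * lprod L I (x k / q)) +
          z * (x k / q + q * w) * (poly (cright (x k)) (x k / q) * rprod L I (x k / q))) +
       z * (x k + q * w) * (\<Prod>j\<in>L - I. phi (x k) (x j)) *
         (w * (x k / q + z) * (poly (cleft (x k)) (x k / q) * lprod L I (x k / q)) +
          z * (x k / q + q * w) * (poly (cden (x k)) (x k / q) * rprod L I (x k / q)))) =
    z * w * (x k + q * z) * (x k + q * w) / q * poly (cleft (x k)) (x k / q) *
      (\<Prod>j\<in>L. poly (cleft (x j)) (x k / q)) * weight z w L I"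
    unfolding y_def by (simp add: mult_ac)
qed

lemma interp_at_0:
  assumes "finite L"
  shows "poly (interp z w L) 0 = (1 + q) * z * w * (\<Prod>j\<in>L. q * x j ^ 3) * cross_sum z w L"
  unfolding poly_interp cross_sum_def sum_distrib_left
proof (intro sum.cong refl)
  fix I assume "I \<in> Pow L"
  then have I: "I \<subseteq> L" by simp
  show "weight z w L I * poly (summand z w L I) 0 =
      (1 + q) * z * w * (\<Prod>j\<in>L. q * x j ^ 3) * weight z w L I"
    unfolding poly_summand poly_cubic_0 prod_split[OF assms I] by (simp add: algebra_simps)
qed

section \<open>Degree bound, leading coefficient and interpolation nodes\<close>

lemma degree_cubic_prod:
  assumes "finite L" "I \<subseteq> L" "\<And>i. degree (f i) \<le> 3" "\<And>i. degree (g i) \<le> 3"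
    "degree c \<le> 1"
  shows "degree (c * ((\<Prod>i\<in>I. f i) * (\<Prod>j\<in>L - I. g j)) :: 'a poly) \<le> 1 + 3 * card L"
    and "coeff (c * ((\<Prod>i\<in>I. f i) * (\<Prod>j\<in>L - I. g j)) :: 'a poly) (1 + 3 * card L) =
      coeff c 1 * ((\<Prod>i\<in>I. coeff (f i) 3) * (\<Prod>j\<in>L - I. coeff (g j) 3))"
proof -
  have fin: "finite I" "finite (L - I)" using assms finite_subset by auto
  have card: "card L = card I + card (L - I)"
    using assms(1,2) card_mono[of L I] by (simp add: card_Diff_subset fin(1))
  have d1: "degree (\<Prod>i\<in>I. f i) \<le> 3 * card I" "degree (\<Prod>j\<in>L - I. g j) \<le> 3 * card (L - I)"
    using degree_prod_le_const fin assms by blast+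
  have d2: "degree ((\<Prod>i\<in>I. f i) * (\<Prod>j\<in>L - I. g j)) \<le> 3 * card I + 3 * card (L - I)"
    using d1 by (intro order.trans[OF degree_mult_le] add_mono)
  show "degree (c * ((\<Prod>i\<in>I. f i) * (\<Prod>j\<in>L - I. g j))) \<le> 1 + 3 * card L"
    unfolding card distrib_left by (rule order.trans[OF degree_mult_le add_mono[OF assms(5) d2]])
  show "coeff (c * ((\<Prod>i\<in>I. f i) * (\<Prod>j\<in>L - I. g j))) (1 + 3 * card L) =
      coeff c 1 * ((\<Prod>i\<in>I. coeff (f i) 3) * (\<Prod>j\<in>L - I. coeff (g j) 3))"
    unfolding card distrib_left coeff_mult_top[OF assms(5) d2] coeff_mult_top[OF d1]
    using fin assms by (simp add: coeff_prod_top)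
qed

lemma degree_interp:
  assumes "finite L"
  shows "degree (interp z w L) \<le> 1 + 3 * card L"
  unfolding interp_def summand_def using assms
  by (intro degree_sum_le order.trans[OF degree_smult_le] degree_add_le degree_cubic_prod)
     (auto simp: degree_cubic)

lemma coeff_interp:
  assumes "finite L"
  shows "coeff (interp z w L) (1 + 3 * card L) = (z + w) * (\<Prod>j\<in>L. - q) * cross_sum z w L"
  unfolding interp_def cross_sum_def sum_distrib_left coeff_sum
proof (intro sum.cong refl)
  fix I assume "I \<in> Pow L"
  then have I: "I \<subseteq> L" by simp
  have "coeff (summand z w L I) (1 + 3 * card L) = (z + w) * (\<Prod>j\<in>L. - q)"
    unfolding summand_def coeff_add prod_split[OF assms I]
    by (subst (1 2) degree_cubic_prod(2)[OF assms I])
       (auto simp: degree_cubic coeff_cubic algebra_simps)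
  then show "coeff (smult (weight z w L I) (summand z w L I)) (1 + 3 * card L) =
      (z + w) * (\<Prod>j\<in>L. - q) * weight z w L I"
    by simp
qed

text \<open>The nodes are as many as the degree bound of \<open>interp\<close>, one short of
  determining the polynomial; the leading coefficient supplies the missing condition.\<close>

lemma card_nodes:
  assumes "finite L"
  shows "card (insert 0 (x ` L \<union> (\<lambda>k. q * x k) ` L \<union> (\<lambda>k. x k / q) ` L)) = 1 + 3 * card L"
proof -
  have eq: "i = j" if "x i = x j \<or> x i = q * x j \<or> x i = q * q * x j" for i j
    using that x_ne x_ne_q x_ne_qq by blast
  have ne: "x i \<noteq> q * x j" "x i \<noteq> q * q * x j" for i j
    using eq[of i j] x0[of j] q1 qq1 by auto
  have inj: "inj_on x L" "inj_on (\<lambda>k. q * x k) L" "inj_on (\<lambda>k. x k / q) L"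
    using eq q0 by (auto simp: inj_on_def)
  have disj: "x ` L \<inter> (\<lambda>k. q * x k) ` L = {}"
      "(x ` L \<union> (\<lambda>k. q * x k) ` L) \<inter> (\<lambda>k. x k / q) ` L = {}"
    using ne q0 by (auto simp: field_simps)
  have "0 \<notin> x ` L \<union> (\<lambda>k. q * x k) ` L \<union> (\<lambda>k. x k / q) ` L"
    using x0 q0 by (auto simp: eq_commute[of 0])
  then show ?thesis
    using assms disj by (simp add: card_Un_disjoint card_image[OF inj(1)]
        card_image[OF inj(2)] card_image[OF inj(3)])
qed

lemma cross_sum_sym:
  assumes "finite L"
  shows "cross_sum z w L = cross_sum w z L"
  using assms
proof (induction L rule: finite_psubset_induct)
  case (psubset M)
  show ?case
  proof (cases "M = {}")
    case True
    then show ?thesis by (simp add: cross_sum_def weight_def)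
  next
    case False
    then obtain n L where M: "M = insert n L" "n \<notin> L"
      by (metis ex_in_conv mk_disjoint_insert)
    have fin: "finite L" using psubset(1) M by simp
    \<comment> \<open>Applied to \<open>L\<close> itself for the value at 0 and the leading
      coefficient, and to \<open>L\<close> without \<open>k\<close> for the values at
      \<open>q * x k\<close> and \<open>x k / q\<close>.\<close>
    have IH: "cross_sum z w K = cross_sum w z K" if "K \<subseteq> L" for K
      using that M psubset(2)[of K] by blast
    let ?A = "insert 0 (x ` L \<union> (\<lambda>k. q * x k) ` L \<union> (\<lambda>k. x k / q) ` L)"
    have "interp z w L = interp w z L"
    proof (rule poly_eqI_degree_lead_coeff[where A = ?A and n = "1 + 3 * card L"])
      show "coeff (interp z w L) (1 + 3 * card L) = coeff (interp w z L) (1 + 3 * card L)"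
        unfolding coeff_interp[OF fin] using IH[of L] by (simp add: add.commute)
      show "1 + 3 * card L \<le> card ?A"
        unfolding card_nodes[OF fin] ..
      show "degree (interp z w L) \<le> 1 + 3 * card L" "degree (interp w z L) \<le> 1 + 3 * card L"
        by (rule degree_interp[OF fin])+
      fix y assume "y \<in> ?A"
      then consider "y = 0" | k where "k \<in> L" "y = x k \<or> y = q * x k \<or> y = x k / q"
        by auto
      then show "poly (interp z w L) y = poly (interp w z L) y"
      proof cases
        case 1
        show ?thesis
          unfolding 1 interp_at_0[OF fin] using IH[of L] by (simp add: mult_ac)
      next
        case 2
        then obtain K where K: "L = insert k K" "k \<notin> K"
          by (metis mk_disjoint_insert)
        then have fK: "finite K" and "cross_sum z w K = cross_sum w z K"
          using fin IH[of K] by auto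
        then show ?thesis
          using 2(2) interp_at_point[OF fK K(2)] interp_at_q_point[OF fK K(2)]
            interp_at_point_div_q[OF fK K(2)]
          unfolding K(1) by (auto simp: mult_ac)
      qed
    qed
    then have "cross_sum z w M * (\<Prod>j\<in>L. poly (cden (x j)) (x n)) =
        cross_sum w z M * (\<Prod>j\<in>L. poly (cden (x j)) (x n))"
      using interp_at_new_point[OF fin M(2)] unfolding M(1) by metis
    moreover have "(\<Prod>j\<in>L. poly (cden (x j)) (x n)) \<noteq> 0"
    proof -
      have "poly (cden (x j)) (x n) \<noteq> 0" if "j \<in> L" for j
        using that M(2) x_ne[of n j] x_ne_q[of n j] x_ne_q[of j n] by (auto simp: poly_cden)
      then show ?thesis using fin by simp
    qed
    ultimately show ?thesis by simp
  qed
qed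

end

subsection \<open>The Vandermonde determinant\<close>

text \<open>Composing with the transposition of \<open>a\<close> and \<open>b\<close> keeps the
  product and flips the sign. Matching even with odd permutations avoids a division by 2.\<close>

lemma permutation_sum_eq_0:
  fixes v :: "'b \<Rightarrow> 'a::comm_ring_1" and e :: "'b \<Rightarrow> nat"
  assumes fin: "finite S" and ab: "a \<in> S" "b \<in> S" "a \<noteq> b" and v: "v a = v b"
  shows "(\<Sum>\<sigma> | \<sigma> permutes S. of_int (sign \<sigma>) * (\<Prod>j\<in>S. v j ^ e (\<sigma> j))) = 0"
proof -
  let ?f = "\<lambda>\<sigma>. \<Prod>j\<in>S. v j ^ e (\<sigma> j)"
  let ?E = "{\<sigma>. \<sigma> permutes S \<and> evenperm \<sigma>}" and ?O = "{\<sigma>. \<sigma> permutes S \<and> \<not> evenperm \<sigma>}"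
  let ?s = "transpose a b"
  have s: "?s permutes S" using ab by (simp add: permutes_swap_id)
  have perm: "permutation \<sigma>" if "\<sigma> permutes S" for \<sigma>
    using that fin permutation_permutes by blast
  have ev: "evenperm (\<sigma> \<circ> ?s) \<longleftrightarrow> \<not> evenperm \<sigma>" if "\<sigma> permutes S" for \<sigma>
    using perm[OF that] ab(3) by (simp add: evenperm_comp evenperm_swap permutation_swap_id)
  have f: "?f (\<sigma> \<circ> ?s) = ?f \<sigma>" for \<sigma>
  proof -
    have "?f \<sigma> = (\<Prod>j\<in>S. v (?s j) ^ e (\<sigma> (?s j)))"
      using prod.permute[OF s, of "\<lambda>j. v j ^ e (\<sigma> j)"] by (simp add: o_def)
    also have "\<dots> = ?f (\<sigma> \<circ> ?s)"
      using v by (intro prod.cong) (auto simp: transpose_def)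
    finally show ?thesis by simp
  qed
  have "sum ?f ?O = sum ?f ?E"
    by (rule sum.reindex_bij_witness[where i = "\<lambda>\<sigma>. \<sigma> \<circ> ?s" and j = "\<lambda>\<sigma>. \<sigma> \<circ> ?s"])
       (auto simp: f[simplified] ev permutes_compose[OF s] o_assoc[symmetric])
  moreover have "(\<Sum>\<sigma> | \<sigma> permutes S. of_int (sign \<sigma>) * ?f \<sigma>) =
      (\<Sum>\<sigma>\<in>?E. of_int (sign \<sigma>) * ?f \<sigma>) + (\<Sum>\<sigma>\<in>?O. of_int (sign \<sigma>) * ?f \<sigma>)"
  proof (subst sum.union_disjoint[symmetric])
    show "finite ?E" "finite ?O" using finite_permutations[OF fin] by (auto elim: rev_finite_subset)
  qed (auto intro: sum.cong)
  moreover have "(\<Sum>\<sigma>\<in>?E. of_int (sign \<sigma>) * ?f \<sigma>) = sum ?f ?E"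
      "(\<Sum>\<sigma>\<in>?O. of_int (sign \<sigma>) * ?f \<sigma>) = - sum ?f ?O"
    by (simp_all add: sign_def sum_negf)
  ultimately show ?thesis by simp
qed

text \<open>Both sides are polynomials in \<open>v m\<close> that vanish at the other
  \<open>v k\<close> and have the smaller determinant as coefficient of degree \<open>N - m\<close>.
  Varying the lower end \<open>m\<close> leaves the exponents \<open>N - \<sigma> j\<close>
  untouched in the induction.\<close>

lemma vandermonde_det:
  fixes v :: "nat \<Rightarrow> 'a::idom"
  assumes "inj_on v {m..N}"
  shows "(\<Sum>\<sigma> | \<sigma> permutes {m..N}. of_int (sign \<sigma>) * (\<Prod>j = m..N. v j ^ (N - \<sigma> j))) =
    (\<Prod>i = m..N. \<Prod>j = Suc i..N. v i - v j)"
  using assms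
proof (induction "Suc N - m" arbitrary: m)
  case 0
  then show ?case by simp
next
  case (Suc d)
  then have mN: "m \<le> N" by simp
  let ?S = "{Suc m..N}"
  have S: "{m..N} = insert m ?S" using mN by auto
  have IH: "(\<Sum>\<sigma> | \<sigma> permutes ?S. of_int (sign \<sigma>) * (\<Prod>j\<in>?S. v j ^ (N - \<sigma> j))) =
      (\<Prod>i\<in>?S. \<Prod>j = Suc i..N. v i - v j)"
    using Suc by (intro Suc.hyps) (auto simp: S)
  let ?c = "\<lambda>\<sigma>. of_int (sign \<sigma>) * (\<Prod>j\<in>?S. v j ^ (N - \<sigma> j))"
  define P where "P = (\<Sum>\<sigma> | \<sigma> permutes {m..N}. monom (?c \<sigma>) (N - \<sigma> m))"
  define R where "R = smult (\<Prod>i\<in>?S. \<Prod>j = Suc i..N. v i - v j) (\<Prod>j\<in>?S. [:- v j, 1:])"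
  have ge: "m \<le> \<sigma> m" if "\<sigma> permutes {m..N}" for \<sigma>
    using permutes_in_image[OF that, of m] mN by simp
  have P: "poly P y = (\<Sum>\<sigma> | \<sigma> permutes {m..N}. of_int (sign \<sigma>) *
      (\<Prod>j = m..N. (v(m := y)) j ^ (N - \<sigma> j)))" for y
    unfolding P_def poly_sum poly_monom S by (intro sum.cong refl) (auto simp: mult_ac intro!: prod.cong)
  have "P = R"
  proof (rule poly_eqI_degree_lead_coeff[where n = "N - m" and A = "v ` ?S"])
    have "coeff P (N - m) = (\<Sum>\<sigma> | \<sigma> permutes {m..N}. if \<sigma> m = m then ?c \<sigma> else 0)"
      unfolding P_def coeff_sum
    proof (intro sum.cong refl)
      fix \<sigma> assume "\<sigma> \<in> {\<sigma>. \<sigma> permutes {m..N}}"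
      then have "\<sigma> m \<in> {m..N}" using mN permutes_in_image[of \<sigma> "{m..N}" m] by simp
      then show "coeff (monom (?c \<sigma>) (N - \<sigma> m)) (N - m) = (if \<sigma> m = m then ?c \<sigma> else 0)"
        by auto
    qed
    also have "\<dots> = (\<Sum>\<sigma> | \<sigma> permutes {m..N} \<and> \<sigma> m = m. ?c \<sigma>)"
      by (simp add: sum.If_cases finite_permutations Int_def)
    \<comment> \<open>The top power of the indeterminate selects the permutations fixing
      \<open>m\<close>, which are those of the remaining columns.\<close>
    also have "{\<sigma>. \<sigma> permutes {m..N} \<and> \<sigma> m = m} = {\<sigma>. \<sigma> permutes ?S}"
      unfolding S by (auto simp: permutes_def)
    finally have cP: "coeff P (N - m) = (\<Prod>i\<in>?S. \<Prod>j = Suc i..N. v i - v j)"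
      using IH by simp
    have "coeff (\<Prod>j\<in>?S. [:- v j, 1:]) (N - m) = 1"
      using coeff_prod_top[of ?S "\<lambda>j. [:- v j, 1:]" 1] by simp
    then show "coeff P (N - m) = coeff R (N - m)"
      by (simp add: cP R_def)
    have "inj_on v ?S" using Suc.prems by (auto intro: inj_on_subset)
    then show "N - m \<le> card (v ` ?S)" by (simp add: card_image)
    show "degree P \<le> N - m" unfolding P_def
      by (intro degree_sum_le) (auto simp: finite_permutations intro!: order.trans[OF degree_monom_le] dest: ge)
    show "degree R \<le> N - m"
      unfolding R_def using degree_prod_le_const[of ?S "\<lambda>j. [:- v j, 1:]" 1]
      by (intro order.trans[OF degree_smult_le]) simp
    fix y assume "y \<in> v ` ?S"
    then obtain k where k: "k \<in> ?S" "y = v k" by auto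
    have "poly P y = 0"
      unfolding P using k mN by (intro permutation_sum_eq_0[of _ m k]) auto
    moreover have "poly R y = 0"
      using k by (auto simp: R_def poly_prod)
    ultimately show "poly P y = poly R y" by simp
  qed
  then have "poly P (v m) = poly R (v m)" by simp
  then show ?case
    unfolding P R_def by (simp add: S poly_prod mult.commute)
qed

subsection \<open>Multiple shifts\<close>

lemma base_const_0 [simp]: "base_const 0 = 0"
  by (simp add: base_const_def Zero_fract_def[where 'a = upoly])

lemma base_const_1 [simp]: "base_const 1 = 1"
  by (simp add: base_const_def One_fract_def[where 'a = upoly])

lemma base_const_mult: "base_const (a * b) = base_const a * base_const b"
  by (simp add: base_const_def mult_single)

lemma base_const_eq_0_iff [simp]: "base_const a = 0 \<longleftrightarrow> a = 0"
  by (simp add: base_const_def Zero_fract_def[where 'a = upoly] eq_fract)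
    (metis lookup_single_eq lookup_zero single_zero)

lemma base_const_inverse: "base_const (inverse a) = inverse (base_const a)"
proof (cases "a = 0")
  case False
  then have "base_const a * base_const (inverse a) = 1"
    by (simp flip: base_const_mult)
  then show ?thesis by (metis inverse_unique)
qed simp

lemma base_const_power: "base_const (a ^ n) = base_const a ^ n"
  by (induction n) (simp_all add: base_const_mult)

lemma inj_base_const: "inj base_const"
proof (rule injI)
  fix a b assume "base_const a = base_const b"
  then have "Poly_Mapping.single (0 :: nat \<Rightarrow>\<^sub>0 nat) a = Poly_Mapping.single 0 b"
    by (simp add: base_const_def eq_fract)
  then show "a = b"
    by (metis lookup_single_eq)
qed

lemma infinite_range_base_const: "infinite (range base_const)"
proof -
  have "inj (\<lambda>n::nat. Fraction_Field.Fract [:[:of_nat n :: rat:]:] 1)"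
    by (rule injI) (simp add: eq_fract)
  then have "infinite (UNIV :: qt_field set)"
    using range_inj_infinite infinite_super subset_UNIV by blast
  then show ?thesis
    using finite_imageD inj_base_const by blast
qed

text \<open>Lets identities between polynomials in \<open>z\<close> be checked at constants, which
  every shift fixes.\<close>

lemma poly_eqI_base_const:
  assumes "\<And>k. poly p (base_const k) = poly r (base_const k)"
  shows "p = r"
proof (rule ccontr)
  assume "p \<noteq> r"
  then have "finite {y. poly (p - r) y = 0}" by (intro poly_roots_finite) simp
  moreover have "range base_const \<subseteq> {y. poly (p - r) y = 0}" using assms by auto
  ultimately show False using infinite_range_base_const finite_subset by blast
qed

text \<open>Compares coefficients of two different monomials. It supplies the conditions of
  \<open>generic_points\<close> and the injectivity of \<open>tscale\<close>.\<close>

lemma uvar_independent: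
  assumes "i \<noteq> j" "a \<noteq> 0"
  shows "base_const a * uvar i \<noteq> base_const b * uvar j"
proof
  assume "base_const a * uvar i = base_const b * uvar j"
  then have "Poly_Mapping.single (Poly_Mapping.single i (1::nat)) a =
      Poly_Mapping.single (Poly_Mapping.single j 1) b"
    by (simp add: base_const_def uvar_def eq_fract mult_single)
  then have "Poly_Mapping.lookup (Poly_Mapping.single (Poly_Mapping.single i (1::nat)) a) (Poly_Mapping.single i (1::nat)) =
      Poly_Mapping.lookup (Poly_Mapping.single (Poly_Mapping.single j (1::nat)) b) (Poly_Mapping.single i (1::nat))"
    by simp
  moreover have "Poly_Mapping.single j (1::nat) \<noteq> Poly_Mapping.single i 1"
    using assms(1) by (metis lookup_single_eq lookup_single_not_eq zero_neq_one)
  ultimately show False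
    using assms(2) by (simp add: lookup_single when_def)
qed

lemma uvar_nonzero [simp]: "uvar i \<noteq> 0"
  by (simp add: uvar_def Zero_fract_def eq_fract) (metis lookup_single_eq lookup_zero zero_neq_one)

abbreviation qu :: ufield where "qu \<equiv> base_const qq"
abbreviation tu :: ufield where "tu \<equiv> base_const tt"

lemma tt_nonzero [simp]: "tt \<noteq> 0"
  by (simp add: tt_def Zero_fract_def eq_fract)

lemma qq_neq_1: "qq \<noteq> 1" "qq * qq \<noteq> 1"
  by (simp_all add: qq_def One_fract_def eq_fract one_pCons)

interpretation gp: generic_points qu tu uvar
proof
  show "qu \<noteq> 0" "tu \<noteq> 0" "uvar i \<noteq> 0" for i by simp_all
  show "qu \<noteq> 1" using qq_neq_1(1) inj_base_const base_const_1 by (metis injD)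
  show "qu * qu \<noteq> 1" using qq_neq_1(2) inj_base_const base_const_1 base_const_mult by (metis injD)
  fix i j :: nat assume "i \<noteq> j"
  from uvar_independent[OF this, of 1] show "uvar i \<noteq> uvar j" "uvar i \<noteq> qu * uvar j"
    "uvar i \<noteq> qu * qu * uvar j"
    by (metis base_const_1 mult_1 one_neq_zero base_const_mult)+
qed

section \<open>Shifts along a finite set of variables\<close>

lemma q_shift_inv_commute: "q_shift_inv i (q_shift_inv j f) = q_shift_inv j (q_shift_inv i f)"
proof -
  obtain a b where f: "f = Fraction_Field.Fract a b" "b \<noteq> 0" by (rule Fract_cases)
  have "q_shift_poly i (q_shift_poly j p) = q_shift_poly j (q_shift_poly i p)" for p
    by transfer (simp add: fun_eq_iff mult_ac)
  then show ?thesis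
    using f by (simp add: q_shift_inv_Fract)
qed

text \<open>A fold over a set is legitimate because the single shifts commute, so no order of the
  columns has to be recorded.\<close>

definition shift :: "nat set \<Rightarrow> ufield \<Rightarrow> ufield" where
  "shift I f = Finite_Set.fold q_shift_inv f I"

interpretation q_shift: comp_fun_commute q_shift_inv
  by standard (simp add: fun_eq_iff q_shift_inv_commute)

lemma shift_empty [simp]: "shift {} f = f"
  by (simp add: shift_def)

lemma shift_insert:
  "finite I \<Longrightarrow> j \<notin> I \<Longrightarrow> shift (insert j I) f = q_shift_inv j (shift I f)"
  by (simp add: shift_def)

lemma shift_singleton: "shift {j} f = q_shift_inv j f"
  by (simp add: shift_insert)

lemma shift_Un:
  assumes "finite A" "finite B" "A \<inter> B = {}"
  shows "shift (A \<union> B) f = shift A (shift B f)"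
  using assms by (induction A) (auto simp: shift_insert)

lemma shift_commute:
  assumes "finite A" "finite B"
  shows "shift A (shift B f) = shift B (shift A f)"
proof -
  have one: "q_shift_inv j (shift B f) = shift B (q_shift_inv j f)" for j f
    using assms(2) by (induction B) (auto simp: shift_insert q_shift_inv_commute)
  show ?thesis
    using assms(1) by (induction A) (auto simp: shift_insert one)
qed

lemma shift_base_const: "finite I \<Longrightarrow> shift I (base_const c) = base_const c"
  by (induction I rule: finite_induct) (auto simp: shift_insert q_shift_inv_base_const)

lemma shift_0: "finite I \<Longrightarrow> shift I 0 = 0"
  using shift_base_const[of I 0] by simp

lemma shift_1: "finite I \<Longrightarrow> shift I 1 = 1"
  using shift_base_const[of I 1] by simp

lemma shift_add: "finite I \<Longrightarrow> shift I (f + g) = shift I f + shift I g"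
  by (induction I rule: finite_induct) (auto simp: shift_insert q_shift_inv_add)

lemma shift_mult: "finite I \<Longrightarrow> shift I (f * g) = shift I f * shift I g"
  by (induction I rule: finite_induct) (auto simp: shift_insert q_shift_inv_mult)

lemma shift_diff: "finite I \<Longrightarrow> shift I (f - g) = shift I f - shift I g"
  using shift_add[of I "f - g" g] by simp

lemma shift_inverse: "finite I \<Longrightarrow> shift I (inverse f) = inverse (shift I f)"
proof (cases "f = 0")
  case False
  assume I: "finite I"
  have "shift I f * shift I (inverse f) = 1"
    using False I by (simp flip: shift_mult add: shift_1)
  then show ?thesis by (metis inverse_unique)
qed (simp add: shift_0)

lemma shift_divide: "finite I \<Longrightarrow> shift I (f / g) = shift I f / shift I g"
  by (simp add: divide_inverse shift_mult shift_inverse)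

lemma shift_power: "finite I \<Longrightarrow> shift I (f ^ n) = shift I f ^ n"
  by (induction n) (auto simp: shift_mult shift_1)

lemma shift_sum: "finite I \<Longrightarrow> shift I (\<Sum>a\<in>A. h a) = (\<Sum>a\<in>A. shift I (h a))"
  by (induction A rule: infinite_finite_induct) (auto simp: shift_add shift_0)

lemma shift_prod: "finite I \<Longrightarrow> shift I (\<Prod>a\<in>A. h a) = (\<Prod>a\<in>A. shift I (h a))"
  by (induction A rule: infinite_finite_induct) (auto simp: shift_mult shift_1)

lemma shift_uvar: "finite I \<Longrightarrow> shift I (uvar i) = (if i \<in> I then uvar i / qu else uvar i)"
  by (induction I rule: finite_induct)
    (auto simp: shift_insert q_shift_inv_uvar base_const_inverse q_shift_inv_mult
      q_shift_inv_base_const divide_inverse simp flip: base_const_inverse)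

lemmas shift_hom = shift_base_const shift_0 shift_1 shift_add shift_mult shift_diff
  shift_inverse shift_divide shift_power shift_sum shift_prod shift_uvar

text \<open>
  An entry of the determinant is \<open>acoef z j (u\<^sub>j / t)\<^bsup>N - i\<^esup> T\<^sub>j\<^sup>-\<^sup>1 + bcoef z j u\<^sub>j\<^bsup>N - i\<^esup>\<close>, so once the
  set \<open>I\<close> of shifted columns is chosen, what remains is the Vandermonde determinant in the
  variables \<open>tscale I j\<close>.
\<close>

definition acoef :: "ufield \<Rightarrow> nat \<Rightarrow> ufield" where
  "acoef c j = c * (1 - 1 / uvar j)"

definition bcoef :: "ufield \<Rightarrow> nat \<Rightarrow> ufield" where
  "bcoef c j = 1 + c / uvar j"

definition tscale :: "nat set \<Rightarrow> nat \<Rightarrow> ufield" where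
  "tscale I j = (if j \<in> I then uvar j / tu else uvar j)"

text \<open>Evaluation commutes with the coefficientwise shift because the point is a constant fixed
  by the shift.\<close>

lemma poly_map_shift: "poly (map_poly (q_shift_inv j) g) (base_const k) = q_shift_inv j (poly g (base_const k))"
proof (induction g)
  case (pCons a g)
  then show ?case
    by (cases "a = 0 \<and> g = 0")
      (auto simp: map_poly_pCons q_shift_inv_add q_shift_inv_mult q_shift_inv_base_const)
qed simp

lemma poly_det_entry:
  assumes "i \<le> N"
  shows "poly (det_entry N i j g) (base_const k) =
    acoef (base_const k) j * (uvar j / tu) ^ (N - i) * shift {j} (poly g (base_const k)) +
    bcoef (base_const k) j * uvar j ^ (N - i) * poly g (base_const k)"
proof -
  have "tt powi (int i - int N) = inverse tt ^ (N - i)"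
    using assms by (simp add: power_int_def nat_diff_distrib')
  then have "base_const (tt powi (int i - int N)) = inverse tu ^ (N - i)"
    by (simp add: base_const_power base_const_inverse)
  then have "poly (det_entry N i j g) (base_const k) = inverse (uvar j) *
      ((uvar j - 1) * uvar j ^ (N - i) * inverse tu ^ (N - i) * base_const k *
         shift {j} (poly g (base_const k)) +
       (uvar j + base_const k) * uvar j ^ (N - i) * poly g (base_const k))"
    by (simp add: det_entry_def zz_def poly_map_shift shift_singleton algebra_simps)
  moreover have "inverse u * ((u - 1) * u ^ n * inverse s ^ n * c * y + (u + c) * u ^ n * y') =
      c * (1 - 1 / u) * (u / s) ^ n * y + (1 + c / u) * u ^ n * y'"
    if "u \<noteq> 0" "s \<noteq> 0" for u s c y y' :: ufield and n
    using that by (simp add: power_inverse power_divide divide_simps)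
  ultimately show ?thesis
    by (simp add: acoef_def bcoef_def)
qed

text \<open>An arbitrary list of distinct columns with an arbitrary bounded row choice
  \<open>s\<close> permits induction on the list. A new column splits each term according to whether
  its shift is taken.\<close>

lemma poly_foldr_det_entry:
  assumes "distinct js" "\<And>j. j \<in> set js \<Longrightarrow> s j \<le> N"
  shows "poly (foldr (\<lambda>j. det_entry N (s j) j) js [:f:]) (base_const k) =
    (\<Sum>I\<in>Pow (set js). (\<Prod>j\<in>I. acoef (base_const k) j) * (\<Prod>j\<in>set js - I. bcoef (base_const k) j) *
       (\<Prod>j\<in>set js. tscale I j ^ (N - s j)) * shift I f)"
  using assms
proof (induction js)
  case Nil
  then show ?case by simp
next
  case (Cons n js)
  define G where "G = poly (foldr (\<lambda>j. det_entry N (s j) j) js [:f:]) (base_const k)"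
  let ?a = "acoef (base_const k)" and ?b = "bcoef (base_const k)"
  let ?c = "\<lambda>I. (\<Prod>j\<in>I. ?a j) * (\<Prod>j\<in>set js - I. ?b j) * (\<Prod>j\<in>set js. tscale I j ^ (N - s j))"
  have n: "n \<notin> set js" "s n \<le> N" using Cons.prems by auto
  have G: "G = (\<Sum>I\<in>Pow (set js). ?c I * shift I f)"
    unfolding G_def using Cons by simp
  \<comment> \<open>Coefficients coming from the other columns do not involve \<open>uvar n\<close>,
    so the new shift acts on \<open>shift I f\<close> alone.\<close>
  have c: "shift {n} (?c I) = ?c I" if "I \<subseteq> set js" for I
  proof -
    have "shift {n} (?a j) = ?a j" "shift {n} (?b j) = ?b j" "shift {n} (tscale I j) = tscale I j"
      if "j \<in> set js" for j
      using that n by (auto simp: acoef_def bcoef_def tscale_def shift_hom)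
    then show ?thesis
      using that by (auto simp: shift_mult shift_prod shift_power subset_iff intro!: arg_cong2[where f = "(*)"] prod.cong)
  qed
  have "poly (foldr (\<lambda>j. det_entry N (s j) j) (n # js) [:f:]) (base_const k) =
      ?a n * (uvar n / tu) ^ (N - s n) * shift {n} G + ?b n * uvar n ^ (N - s n) * G"
    using n by (simp add: poly_det_entry G_def)
  also have "\<dots> = (\<Sum>I\<in>Pow (set js). ?b n * uvar n ^ (N - s n) * (?c I * shift I f) +
      ?a n * (uvar n / tu) ^ (N - s n) * (?c I * shift {n} (shift I f)))"
    using c by (simp add: G shift_sum shift_mult sum_distrib_left sum.distrib add.commute)
  also have "\<dots> = (\<Sum>I\<in>Pow (set (n # js)). (\<Prod>j\<in>I. ?a j) * (\<Prod>j\<in>set (n # js) - I. ?b j) *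
       (\<Prod>j\<in>set (n # js). tscale I j ^ (N - s j)) * shift I f)"
    unfolding list.set(2) sum_Pow_insert[OF finite_set n(1)]
  proof (intro sum.cong refl arg_cong2[where f = "(+)"])
    fix I assume "I \<in> Pow (set js)"
    then have I: "n \<notin> I" "finite I" "insert n (set js) - I = insert n (set js - I)"
      "insert n (set js) - insert n I = set js - I"
      using n finite_subset by auto
    have t: "(\<Prod>j\<in>set js. tscale (insert n I) j ^ (N - s j)) = (\<Prod>j\<in>set js. tscale I j ^ (N - s j))"
      using n by (intro prod.cong) (auto simp: tscale_def)
    show "?b n * uvar n ^ (N - s n) * (?c I * shift I f) =
        (\<Prod>j\<in>I. ?a j) * (\<Prod>j\<in>insert n (set js) - I. ?b j) *
         (\<Prod>j\<in>insert n (set js). tscale I j ^ (N - s j)) * shift I f"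
      using I n by (simp add: tscale_def mult_ac)
    show "?a n * (uvar n / tu) ^ (N - s n) * (?c I * shift {n} (shift I f)) =
        (\<Prod>j\<in>insert n I. ?a j) * (\<Prod>j\<in>insert n (set js) - insert n I. ?b j) *
         (\<Prod>j\<in>insert n (set js). tscale (insert n I) j ^ (N - s j)) * shift (insert n I) f"
      using I n by (simp add: t shift_insert shift_singleton) (simp add: tscale_def mult_ac)
  qed
  finally show ?case .
qed

section \<open>Products over pairs and the expanded generating operator\<close>

definition pairprod :: "nat \<Rightarrow> (nat \<Rightarrow> nat \<Rightarrow> ufield) \<Rightarrow> ufield" where
  "pairprod N g = (\<Prod>i = 1..N. \<Prod>j = Suc i..N. g i j)"

lemma pairprod_mult: "pairprod N (\<lambda>i j. g i j * h i j) = pairprod N g * pairprod N h"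
  by (simp add: pairprod_def prod.distrib)

lemma pairprod_divide: "pairprod N (\<lambda>i j. g i j / h i j) = pairprod N g / pairprod N h"
  by (simp add: pairprod_def prod_dividef)

lemma pairprod_cong:
  "(\<And>i j. i \<in> {1..N} \<Longrightarrow> j \<in> {1..N} \<Longrightarrow> i \<noteq> j \<Longrightarrow> g i j = h i j) \<Longrightarrow> pairprod N g = pairprod N h"
  unfolding pairprod_def by (intro prod.cong) auto

lemma pairprod_square:
  "(\<Prod>i = 1..N. \<Prod>j = 1..N. g i j) = (\<Prod>i = 1..N. g i i) * pairprod N (\<lambda>i j. g i j * g j i)"
proof (induction N)
  case (Suc N)
  have "(\<Prod>j = Suc i..Suc N. h j) = (\<Prod>j = Suc i..N. h j) * h (Suc N)"
    if "i \<in> {1..N}" for i and h :: "nat \<Rightarrow> ufield"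
    using that by (simp add: prod.nat_ivl_Suc')
  then have "pairprod (Suc N) h = pairprod N h * (\<Prod>i = 1..N. h i (Suc N))"
    for h :: "nat \<Rightarrow> nat \<Rightarrow> ufield"
    by (simp add: pairprod_def prod.nat_ivl_Suc' prod.distrib)
  then show ?case
    using Suc by (simp add: prod.nat_ivl_Suc' prod.distrib mult_ac)
qed (simp add: pairprod_def)

lemma vandermonde_pairprod: "vandermonde N = pairprod N (\<lambda>i j. uvar i - uvar j)"
  by (simp add: vandermonde_def pairprod_def)

lemma vandermonde_nonzero: "vandermonde N \<noteq> 0"
  by (auto simp: vandermonde_def gp.x_ne)

text \<open>This is \<open>A\<^sub>I\<close> at the constant \<open>c\<close>. The numerator of the
  quotient is the Vandermonde determinant in the variables \<open>tscale I j\<close>.\<close>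

definition coef :: "nat \<Rightarrow> ufield \<Rightarrow> nat set \<Rightarrow> ufield" where
  "coef N c I = (\<Prod>j\<in>I. acoef c j) * (\<Prod>j\<in>{1..N} - I. bcoef c j) *
     (pairprod N (\<lambda>i j. tscale I i - tscale I j) / vandermonde N)"

definition evalop :: "nat \<Rightarrow> ufield \<Rightarrow> ufield \<Rightarrow> ufield" where
  "evalop N c f = (\<Sum>I\<in>Pow {1..N}. coef N c I * shift I f)"

lemma inj_tscale: "inj_on (tscale I) A"
proof (rule inj_onI, rule ccontr)
  fix i j assume eq: "tscale I i = tscale I j" and ij: "i \<noteq> j"
  define a where "a l = (if l \<in> I then inverse tt else 1)" for l
  have "tscale I l = base_const (a l) * uvar l" for l
    by (simp add: tscale_def a_def base_const_inverse divide_inverse mult.commute)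
  moreover have "a i \<noteq> 0" by (simp add: a_def)
  ultimately show False using uvar_independent[OF ij] eq by metis
qed

text \<open>Once the sums over permutations and over \<open>I\<close> are exchanged, the inner sum
  is evaluated by \<open>vandermonde_det\<close> at the distinct values
  \<open>tscale I j\<close>.\<close>

lemma poly_generating_operator:
  "poly (generating_operator N [:f:]) (base_const k) = evalop N (base_const k) f"
proof -
  let ?c = "base_const k"
  let ?P = "{\<sigma>. \<sigma> permutes {1..N}}"
  have set: "set [1..<Suc N] = {1..N}" by auto
  let ?ab = "\<lambda>I. (\<Prod>j\<in>I. acoef ?c j) * (\<Prod>j\<in>{1..N} - I. bcoef ?c j)"
  have "poly (foldr (\<lambda>j. det_entry N (\<sigma> j) j) [1..<Suc N] [:f:]) ?c =
      (\<Sum>I\<in>Pow {1..N}. ?ab I * (\<Prod>j = 1..N. tscale I j ^ (N - \<sigma> j)) * shift I f)"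
    if "\<sigma> \<in> ?P" for \<sigma>
  proof (subst poly_foldr_det_entry)
    show "\<sigma> j \<le> N" if "j \<in> set [1..<Suc N]" for j
      using that \<open>\<sigma> \<in> ?P\<close> permutes_in_image[of \<sigma> "{1..N}" j] unfolding set by auto
  qed (simp_all only: set distinct_upt)
  then have "poly (generating_operator N [:f:]) ?c = inverse (vandermonde N) *
      (\<Sum>\<sigma>\<in>?P. \<Sum>I\<in>Pow {1..N}. of_int (sign \<sigma>) *
         (?ab I * (\<Prod>j = 1..N. tscale I j ^ (N - \<sigma> j)) * shift I f))"
    unfolding generating_operator_def operator_det_def poly_mult poly_sum
    by (simp add: sum_distrib_left poly_of_int del: upt_Suc foldr.simps)
  also have "\<dots> = (\<Sum>I\<in>Pow {1..N}. \<Sum>\<sigma>\<in>?P. inverse (vandermonde N) * (of_int (sign \<sigma>) *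
         (?ab I * (\<Prod>j = 1..N. tscale I j ^ (N - \<sigma> j)) * shift I f)))"
    unfolding sum_distrib_left by (rule sum.swap)
  also have "\<dots> = evalop N ?c f"
    unfolding evalop_def
  proof (intro sum.cong refl)
    fix I
    have "(\<Sum>\<sigma>\<in>?P. inverse (vandermonde N) * (of_int (sign \<sigma>) *
         (?ab I * (\<Prod>j = 1..N. tscale I j ^ (N - \<sigma> j)) * shift I f))) =
        inverse (vandermonde N) * ?ab I * shift I f *
        (\<Sum>\<sigma>\<in>?P. of_int (sign \<sigma>) * (\<Prod>j = 1..N. tscale I j ^ (N - \<sigma> j)))"
      unfolding sum_distrib_left by (intro sum.cong) (simp_all add: mult_ac)
    then show "(\<Sum>\<sigma>\<in>?P. inverse (vandermonde N) * (of_int (sign \<sigma>) *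
         (?ab I * (\<Prod>j = 1..N. tscale I j ^ (N - \<sigma> j)) * shift I f))) = coef N ?c I * shift I f"
      unfolding vandermonde_det[OF inj_tscale]
      by (simp add: coef_def pairprod_def divide_inverse mult_ac)
  qed
  finally show ?thesis .
qed

subsection \<open>Products of generating operators\<close>

text \<open>The contribution of one pair of variables to the two Vandermonde quotients when a term
  shifting \<open>I\<close> is composed with a term shifting \<open>J\<close>.\<close>

definition pair_ratio :: "nat set \<Rightarrow> nat set \<Rightarrow> nat \<Rightarrow> nat \<Rightarrow> ufield" where
  "pair_ratio I J i j =
     ((tscale I i - tscale I j) * (shift I (tscale J i) - shift I (tscale J j))) /
     ((uvar i - uvar j) * (shift I (uvar i) - shift I (uvar j)))"

text \<open>
  The pair \<open>K, L\<close> consists of the variables shifted twice and once, respectively.  The split of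
  \<open>L\<close> between the two operators is felt only through the factors \<open>phi\<close>.
\<close>

lemma pair_ratio_split:
  assumes fin: "finite K" "finite L" and KL: "K \<inter> L = {}" and I: "I \<subseteq> L" and ij: "i \<noteq> j"
  shows "pair_ratio (K \<union> I) (K \<union> (L - I)) i j = pair_ratio (K \<union> L) K i j *
    ((if i \<in> I \<and> j \<in> L - I then gp.phi (uvar i) (uvar j) else 1) *
     (if j \<in> I \<and> i \<in> L - I then gp.phi (uvar j) (uvar i) else 1))"
proof -
  have fI: "finite I" using fin(2) I finite_subset by blast
  have ne: "uvar i \<noteq> uvar j" "uvar j \<noteq> uvar i" "uvar i \<noteq> qu * uvar j" "uvar j \<noteq> qu * uvar i"
    "uvar i \<noteq> uvar j * qu" "uvar j \<noteq> uvar i * qu" "qu * uvar j \<noteq> uvar i" "qu * uvar i \<noteq> uvar j"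
    "uvar j * qu \<noteq> uvar i" "uvar i * qu \<noteq> uvar j"
    using gp.points_ne[OF ij] by (auto simp: mult.commute)
  note [simp] = ne
  show ?thesis
    using fin fI KL I unfolding pair_ratio_def gp.phi_def tscale_def
    \<comment> \<open>Membership in \<open>K\<close>, \<open>I\<close> and \<open>L\<close> fixes
      every scaling and shift, so each case is an identity of rational functions; the facts
      \<open>ne\<close> clear the denominators.\<close>
    by (cases "i \<in> K"; cases "j \<in> K"; cases "i \<in> I"; cases "j \<in> I"; cases "i \<in> L"; cases "j \<in> L")
      (auto simp: shift_hom divide_simps, (simp_all add: algebra_simps)?)
qed


text \<open>Passes from ordered pairs in a square to unordered pairs by
  \<open>pairprod_square\<close>; the diagonal contributes 1 because \<open>I\<close> and
  \<open>L - I\<close> are disjoint.\<close>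

lemma pairprod_phi:
  assumes "I \<subseteq> L" "L \<subseteq> {1..N}"
  shows "pairprod N (\<lambda>i j. (if i \<in> I \<and> j \<in> L - I then gp.phi (uvar i) (uvar j) else 1) *
     (if j \<in> I \<and> i \<in> L - I then gp.phi (uvar j) (uvar i) else 1)) =
    (\<Prod>i\<in>I. \<Prod>j\<in>L - I. gp.phi (uvar i) (uvar j))"
proof -
  let ?g = "\<lambda>i j. if i \<in> I \<and> j \<in> L - I then gp.phi (uvar i) (uvar j) else 1"
  have "(\<Prod>i\<in>I. \<Prod>j\<in>L - I. gp.phi (uvar i) (uvar j)) = (\<Prod>i\<in>I. \<Prod>j = 1..N. ?g i j)"
    using assms by (intro prod.cong refl prod.mono_neutral_cong_left) auto
  also have "\<dots> = (\<Prod>i = 1..N. \<Prod>j = 1..N. ?g i j)"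
    using assms by (intro prod.mono_neutral_left) auto
  also have "\<dots> = pairprod N (\<lambda>i j. ?g i j * ?g j i)"
  proof -
    have "(\<Prod>i = 1..N. ?g i i) = 1" by (intro prod.neutral) auto
    then show ?thesis unfolding pairprod_square by simp
  qed
  finally show ?thesis by simp
qed

text \<open>Collects what does not depend on the splitting of \<open>L\<close>. A variable in
  \<open>K\<close> meets the second operator already shifted, hence
  \<open>1 - qu / uvar j\<close>.\<close>

definition common_factor :: "nat \<Rightarrow> ufield \<Rightarrow> ufield \<Rightarrow> nat set \<Rightarrow> nat set \<Rightarrow> ufield" where
  "common_factor N c d K L =
     (\<Prod>j\<in>K. c * d * (1 - 1 / uvar j) * (1 - qu / uvar j)) *
     (\<Prod>j\<in>{1..N} - (K \<union> L). bcoef c j * bcoef d j) *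
     (\<Prod>j\<in>L. (1 - 1 / uvar j) / uvar j) * pairprod N (pair_ratio (K \<union> L) K)"

lemma common_factor_sym: "common_factor N c d K L = common_factor N d c K L"
  by (simp add: common_factor_def mult_ac)

text \<open>Factors are sorted by whether a variable is shifted twice (\<open>K\<close>), never
  (\<open>?M\<close>), only by the first operator (\<open>I\<close>) or only by the second
  (\<open>L - I\<close>). On \<open>I\<close> the shift turns \<open>bcoef d j\<close> into
  \<open>1 + d * qu / uvar j\<close>, the source of the factors \<open>x i + q * w\<close> in
  \<open>weight\<close>; on \<open>L - I\<close> the unshifted \<open>bcoef c j\<close> gives
  \<open>x j + z\<close>.\<close>

lemma coef_mult_shift_coef:
  fixes c' d' :: qt_field
  defines "c \<equiv> base_const c'" and "d \<equiv> base_const d'"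
  assumes K: "K \<subseteq> {1..N}" and L: "L \<subseteq> {1..N}" and KL: "K \<inter> L = {}" and I: "I \<subseteq> L"
  shows "coef N c (K \<union> I) * shift (K \<union> I) (coef N d (K \<union> (L - I))) =
    common_factor N c d K L * gp.weight c d L I"
proof -
  let ?M = "{1..N} - (K \<union> L)" and ?J = "L - I"
  have fin: "finite K" "finite L" "finite I" "finite ?J" "finite ?M"
    using K L I by (auto intro: finite_subset)
  have fKI: "finite (K \<union> I)" using fin by simp
  have disj: "K \<inter> I = {}" "K \<inter> ?J = {}" "?M \<inter> ?J = {}" "?M \<inter> I = {}"
    using KL I by auto
  have compl: "{1..N} - (K \<union> I) = ?M \<union> ?J" "{1..N} - (K \<union> ?J) = ?M \<union> I"
    using K L I KL by auto
  have sa: "shift (K \<union> I) (\<Prod>j\<in>K \<union> ?J. acoef d j) =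
      (\<Prod>j\<in>K. d * (1 - qu / uvar j)) * (\<Prod>j\<in>?J. acoef d j)"
    using disj KL by (simp add: prod.union_disjoint fin shift_prod shift_mult acoef_def d_def)
      (auto simp: shift_hom fin intro!: arg_cong2[where f = "(*)"] prod.cong)
  have sb: "shift (K \<union> I) (\<Prod>j\<in>?M \<union> I. bcoef d j) =
      (\<Prod>j\<in>?M. bcoef d j) * (\<Prod>j\<in>I. 1 + d * qu / uvar j)"
  proof -
    have "shift (K \<union> I) (bcoef d j) = bcoef d j" if "j \<in> ?M" for j
      using that I by (auto simp: bcoef_def d_def shift_hom fin)
    moreover have "shift (K \<union> I) (bcoef d j) = 1 + d * qu / uvar j" if "j \<in> I" for j
      using that by (simp add: bcoef_def d_def shift_hom fin)
    ultimately show ?thesis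
      using disj by (simp add: prod.union_disjoint fin shift_prod shift_mult)
  qed
  have sp: "pairprod N (\<lambda>i j. tscale (K \<union> I) i - tscale (K \<union> I) j) / vandermonde N *
      shift (K \<union> I) (pairprod N (\<lambda>i j. tscale (K \<union> ?J) i - tscale (K \<union> ?J) j) / vandermonde N) =
      pairprod N (pair_ratio (K \<union> L) K) * (\<Prod>i\<in>I. \<Prod>j\<in>?J. gp.phi (uvar i) (uvar j))"
  proof -
    have "pairprod N (pair_ratio (K \<union> I) (K \<union> ?J)) = pairprod N (\<lambda>i j. pair_ratio (K \<union> L) K i j *
      ((if i \<in> I \<and> j \<in> L - I then gp.phi (uvar i) (uvar j) else 1) *
       (if j \<in> I \<and> i \<in> L - I then gp.phi (uvar j) (uvar i) else 1)))"
      using pair_ratio_split[OF fin(1,2) KL I] by (intro pairprod_cong) blast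
    moreover have "pairprod N (pair_ratio (K \<union> I) (K \<union> ?J)) =
        pairprod N (\<lambda>i j. tscale (K \<union> I) i - tscale (K \<union> I) j) / vandermonde N *
        shift (K \<union> I) (pairprod N (\<lambda>i j. tscale (K \<union> ?J) i - tscale (K \<union> ?J) j) / vandermonde N)"
      unfolding pair_ratio_def pairprod_divide pairprod_mult shift_divide[OF fKI] vandermonde_pairprod
      by (simp add: pairprod_def shift_prod[OF fKI] shift_diff[OF fKI])
    ultimately show ?thesis
      unfolding pairprod_mult[of N "pair_ratio (K \<union> L) K"] pairprod_phi[OF I L] by simp
  qed
  have I_prod: "(\<Prod>j\<in>I. acoef c j) * (\<Prod>j\<in>I. 1 + d * qu / uvar j) =
      (\<Prod>j\<in>I. (1 - 1 / uvar j) / uvar j) * (\<Prod>j\<in>I. c * (uvar j + qu * d))"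
    unfolding prod.distrib[symmetric]
    by (intro prod.cong refl) (simp add: acoef_def divide_simps)
  have J_prod: "(\<Prod>j\<in>?J. acoef d j) * (\<Prod>j\<in>?J. bcoef c j) =
      (\<Prod>j\<in>?J. (1 - 1 / uvar j) / uvar j) * (\<Prod>j\<in>?J. d * (uvar j + c))"
    unfolding prod.distrib[symmetric]
    by (intro prod.cong refl) (simp add: acoef_def bcoef_def divide_simps)
  have K_prod: "(\<Prod>j\<in>K. acoef c j) * (\<Prod>j\<in>K. d * (1 - qu / uvar j)) =
      (\<Prod>j\<in>K. c * d * (1 - 1 / uvar j) * (1 - qu / uvar j))"
    unfolding prod.distrib[symmetric] by (simp add: acoef_def mult_ac)
  have "coef N c (K \<union> I) * shift (K \<union> I) (coef N d (K \<union> ?J)) =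
      ((\<Prod>j\<in>K. acoef c j) * (\<Prod>j\<in>K. d * (1 - qu / uvar j))) *
      ((\<Prod>j\<in>?M. bcoef c j) * (\<Prod>j\<in>?M. bcoef d j)) *
      ((\<Prod>j\<in>I. acoef c j) * (\<Prod>j\<in>I. 1 + d * qu / uvar j)) *
      ((\<Prod>j\<in>?J. acoef d j) * (\<Prod>j\<in>?J. bcoef c j)) *
      (pairprod N (\<lambda>i j. tscale (K \<union> I) i - tscale (K \<union> I) j) / vandermonde N *
      shift (K \<union> I) (pairprod N (\<lambda>i j. tscale (K \<union> ?J) i - tscale (K \<union> ?J) j) / vandermonde N))"
    unfolding coef_def compl shift_mult[OF fKI] sa sb
      prod.union_disjoint[OF fin(1,3) disj(1)] prod.union_disjoint[OF fin(5,4) disj(3)]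
    by (simp only: mult_ac)
  also have "\<dots> = common_factor N c d K L * gp.weight c d L I"
    unfolding I_prod J_prod K_prod sp common_factor_def gp.weight_def
      gp.prod_split[OF fin(2) I, of "\<lambda>j. (1 - 1 / uvar j) / uvar j"] prod.distrib[of "bcoef c"]
    by (simp only: mult_ac)
  finally show ?thesis .
qed

text \<open>A pair \<open>I, J\<close> is encoded by its intersection \<open>K\<close>, its
  symmetric difference \<open>L\<close> and the part \<open>I - J\<close> of
  \<open>L\<close>.\<close>

lemma sum_Pow_pairs:
  assumes "finite S"
  shows "(\<Sum>I\<in>Pow S. \<Sum>J\<in>Pow S. F I J) =
    (\<Sum>K\<in>Pow S. \<Sum>L\<in>Pow (S - K). \<Sum>I\<in>Pow L. F (K \<union> I) (K \<union> (L - I)))"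
proof -
  have fin: "finite (Pow (S - K))" "L \<in> Pow (S - K) \<Longrightarrow> finite (Pow L)" for K L
    using assms finite_subset[of L S] by auto
  have "(\<Sum>I\<in>Pow S. \<Sum>J\<in>Pow S. F I J) = (\<Sum>(I, J)\<in>Pow S \<times> Pow S. F I J)"
    by (simp add: sum.cartesian_product)
  also have "\<dots> = (\<Sum>(K, L, I)\<in>(SIGMA K:Pow S. SIGMA L:Pow (S - K). Pow L). F (K \<union> I) (K \<union> (L - I)))"
  proof (rule sum.reindex_bij_witness[where i = "\<lambda>(K, L, I). (K \<union> I, K \<union> (L - I))"
        and j = "\<lambda>(I, J). (I \<inter> J, (I - J) \<union> (J - I), I - J)"], goal_cases)
    case (5 a)
    then obtain I J where a: "a = (I, J)" by (cases a)
    have "(I \<inter> J) \<union> (I - J) = I" "(I \<inter> J) \<union> ((I - J) \<union> (J - I) - (I - J)) = J" by auto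
    then show ?case by (simp add: a)
  qed auto
  also have "\<dots> = (\<Sum>K\<in>Pow S. \<Sum>L\<in>Pow (S - K). \<Sum>I\<in>Pow L. F (K \<union> I) (K \<union> (L - I)))"
  proof -
    have "(\<Sum>L\<in>Pow (S - K). \<Sum>I\<in>Pow L. F (K \<union> I) (K \<union> (L - I))) =
        (\<Sum>(L, I)\<in>(SIGMA L:Pow (S - K). Pow L). F (K \<union> I) (K \<union> (L - I)))" for K
      using fin by (intro sum.Sigma) auto
    moreover have "finite (SIGMA L:Pow (S - K). Pow L)" for K
      using fin by (intro finite_SigmaI) auto
    ultimately show ?thesis
      using assms by (simp add: sum.Sigma)
  qed
  finally show ?thesis .
qed

text \<open>Since shifts commute, the composite shift depends only on \<open>K\<close> and
  \<open>L\<close>. The sum over the splittings of \<open>L\<close> therefore collapses to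
  \<open>cross_sum\<close>.\<close>

lemma evalop_evalop:
  fixes c' d' :: qt_field
  defines "c \<equiv> base_const c'" and "d \<equiv> base_const d'"
  shows "evalop N c (evalop N d f) = (\<Sum>K\<in>Pow {1..N}. \<Sum>L\<in>Pow ({1..N} - K).
    common_factor N c d K L * gp.cross_sum c d L * shift K (shift K (shift L f)))"
proof -
  have fS: "finite I" if "I \<in> Pow {1..N}" for I using that finite_subset by auto
  have "evalop N c (evalop N d f) = (\<Sum>I\<in>Pow {1..N}. \<Sum>J\<in>Pow {1..N}.
      coef N c I * shift I (coef N d J) * shift I (shift J f))"
    unfolding evalop_def
    by (intro sum.cong refl) (simp add: fS shift_sum shift_mult sum_distrib_left mult_ac)
  also have "\<dots> = (\<Sum>K\<in>Pow {1..N}. \<Sum>L\<in>Pow ({1..N} - K). \<Sum>I\<in>Pow L.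
      coef N c (K \<union> I) * shift (K \<union> I) (coef N d (K \<union> (L - I))) *
        shift (K \<union> I) (shift (K \<union> (L - I)) f))"
    by (simp add: sum_Pow_pairs)
  also have "\<dots> = (\<Sum>K\<in>Pow {1..N}. \<Sum>L\<in>Pow ({1..N} - K).
    common_factor N c d K L * gp.cross_sum c d L * shift K (shift K (shift L f)))"
    unfolding gp.cross_sum_def sum_distrib_left sum_distrib_right
  proof (intro sum.cong refl)
    fix K L I assume asm: "K \<in> Pow {1..N}" "L \<in> Pow ({1..N} - K)" "I \<in> Pow L"
    then have sub: "K \<subseteq> {1..N}" "L \<subseteq> {1..N}" "K \<inter> L = {}" "I \<subseteq> L" by auto
    then have fin: "finite K" "finite L" "finite I" "finite (L - I)"
      using finite_subset[of _ "{1..N}"] finite_subset[of I L] by auto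
    have "shift (K \<union> I) (shift (K \<union> (L - I)) f) = shift K (shift I (shift K (shift (L - I) f)))"
      using sub fin by (subst (1 2) shift_Un) auto
    also have "\<dots> = shift K (shift K (shift I (shift (L - I) f)))"
      using fin by (simp add: shift_commute[of I K])
    also have "shift I (shift (L - I) f) = shift L f"
      using sub fin shift_Un[of I "L - I" f] by (simp add: Un_absorb1)
    finally show "coef N c (K \<union> I) * shift (K \<union> I) (coef N d (K \<union> (L - I))) *
        shift (K \<union> I) (shift (K \<union> (L - I)) f) =
      common_factor N c d K L * gp.weight c d L I * shift K (shift K (shift L f))"
      using coef_mult_shift_coef[OF sub] by (simp add: c_def d_def)
  qed
  finally show ?thesis .
qed

lemma evalop_commute:
  "evalop N (base_const c) (evalop N (base_const d) f) =
   evalop N (base_const d) (evalop N (base_const c) f)"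
  unfolding evalop_evalop
  by (intro sum.cong refl arg_cong2[where f = "(*)"] common_factor_sym gp.cross_sum_sym)
     (auto intro: finite_subset)

section \<open>From values at constants to coefficients of powers of \<open>z\<close>\<close>

lemma evalop_linear:
  "evalop N c (base_const k * f + g) = base_const k * evalop N c f + evalop N c g"
proof -
  have fS: "finite I" if "I \<in> Pow {1..N}" for I using that finite_subset by auto
  show ?thesis
    unfolding evalop_def sum_distrib_left sum.distrib[symmetric]
    by (intro sum.cong refl) (simp add: fS shift_add shift_mult shift_base_const algebra_simps)
qed

text \<open>Every \<open>acoef\<close> vanishes at 0, so only the unshifted term remains; this
  yields the constant term 1 of the expansion.\<close>

lemma evalop_0:
  "evalop N 0 f = f"
proof -
  have a: "(\<Prod>j\<in>I. acoef 0 j) = 0" if "I \<in> Pow {1..N} - {{}}" for I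
    using that finite_subset[of I "{1..N}"] by (auto simp: acoef_def)
  have "evalop N 0 f = (\<Sum>I\<in>{{}}. coef N 0 I * shift I f)"
    unfolding evalop_def by (intro sum.mono_neutral_right) (auto simp: coef_def a)
  also have "\<dots> = f"
    using vandermonde_nonzero[of N]
    by (simp add: coef_def bcoef_def tscale_def vandermonde_pairprod[symmetric])
  finally show ?thesis by simp
qed

text \<open>Each of the \<open>N\<close> columns raises the degree in \<open>z\<close> by at most
  one.\<close>

lemma degree_generating_operator: "degree (generating_operator N [:f:]) \<le> N"
proof -
  have entry: "degree (det_entry n i j g) \<le> Suc (degree g)" for n i j g
  proof -
    have z: "degree zz = 1" by (simp add: zz_def)
    have m: "degree (map_poly (q_shift_inv j) g) \<le> degree g" by (rule map_poly_degree_leq)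
    have const: "degree ([:a:] * p) \<le> degree p" for a :: ufield and p
      by (simp add: degree_smult_le)
    have "degree ([:a:] * zz * map_poly (q_shift_inv j) g) \<le> Suc (degree g)" for a
      using degree_mult_le[of "[:a:] * zz" "map_poly (q_shift_inv j) g"] const[of a zz] m z by simp
    moreover have "degree (([:uvar j:] + zz) * [:a:] * g) \<le> Suc (degree g)" for a
      using degree_mult_le[of "([:uvar j:] + zz) * [:a:]" g] const[of a "[:uvar j:] + zz"]
      by (simp add: zz_def mult.commute)
    ultimately show ?thesis
      unfolding det_entry_def by (intro order.trans[OF const] degree_add_le)
  qed
  have "degree (foldr (\<lambda>j. det_entry N (\<sigma> j) j) js [:f:]) \<le> length js" for \<sigma> js
    by (induction js) (auto intro: order.trans[OF entry])
  from this[of _ "[1..<Suc N]"]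
  have fold: "degree (foldr (\<lambda>j. det_entry N (\<sigma> j) j) [1..<Suc N] [:f:]) \<le> N" for \<sigma>
    by (simp del: upt_Suc)
  have "degree (of_int (sign \<sigma>) * p) \<le> degree p" for \<sigma> :: "nat \<Rightarrow> nat" and p :: "ufield poly"
    by (simp add: sign_def)
  then have "degree (operator_det N (det_entry N) [:f:]) \<le> N"
    unfolding operator_det_def
    by (intro degree_sum_le order.trans[OF _ fold]) (auto simp: finite_permutations)
  then show ?thesis
    unfolding generating_operator_def by (simp add: degree_smult_le order.trans)
qed

lemma generating_operator_expansion:
  "generating_operator N [:f:] = (\<Sum>r\<le>N. monom (D_hat N r f) r)"
proof (rule poly_eqI)
  fix r
  show "coeff (generating_operator N [:f:]) r = coeff (\<Sum>r\<le>N. monom (D_hat N r f) r) r"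
    using degree_generating_operator[of N f]
    by (cases "r \<le> N") (auto simp: coeff_sum D_hat_def coeff_eq_0 coeff_eq_0[OF le_less_trans])
qed

lemma evalop_expansion:
  "evalop N (base_const k) f = (\<Sum>r\<le>N. base_const k ^ r * D_hat N r f)"
  by (simp add: poly_generating_operator[symmetric] generating_operator_expansion poly_sum
      poly_monom mult.commute)

text \<open>Linearity over the constants passes from \<open>evalop\<close> to its coefficients, and
  lets \<open>D_hat\<close> be applied termwise to \<open>evalop_expansion\<close>.\<close>

lemma D_hat_linear: "D_hat N r (base_const k * f + g) = base_const k * D_hat N r f + D_hat N r g"
proof -
  have "generating_operator N [:base_const k * f + g:] =
      smult (base_const k) (generating_operator N [:f:]) + generating_operator N [:g:]"
    by (intro poly_eqI_base_const) (simp add: poly_generating_operator evalop_linear)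
  then show ?thesis by (simp add: D_hat_def)
qed

lemma D_hat_0 [simp]: "D_hat N r 0 = 0"
  using D_hat_linear[of N r 1 0 0]
  by (simp only: base_const_1 mult_1 add_0 add_cancel_right_right)

lemma D_hat_sum: "D_hat N r (\<Sum>s\<in>A. base_const (k s) * f s) = (\<Sum>s\<in>A. base_const (k s) * D_hat N r (f s))"
  by (induction A rule: infinite_finite_induct) (auto simp: D_hat_linear)

lemma evalop_sum: "evalop N (base_const c) (\<Sum>s\<in>A. base_const (k s) * f s) =
    (\<Sum>s\<in>A. base_const (k s) * evalop N (base_const c) (f s))"
proof (induction A rule: infinite_finite_induct)
  case empty
  show ?case by (simp add: evalop_expansion)
qed (auto simp: evalop_linear evalop_expansion[of _ _ 0])

text \<open>The first extraction: with \<open>d\<close> fixed, \<open>evalop_commute\<close> at all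
  constants \<open>k\<close> becomes an identity of polynomials in \<open>z\<close>, whose
  coefficients are compared.\<close>

lemma D_hat_evalop:
  assumes "r \<le> N"
  shows "D_hat N r (evalop N (base_const d) f) = evalop N (base_const d) (D_hat N r f)"
proof -
  have "generating_operator N [:evalop N (base_const d) f:] =
      (\<Sum>r\<le>N. monom (evalop N (base_const d) (D_hat N r f)) r)"
  proof (rule poly_eqI_base_const)
    fix k
    have "poly (generating_operator N [:evalop N (base_const d) f:]) (base_const k) =
        evalop N (base_const d) (evalop N (base_const k) f)"
      by (simp add: poly_generating_operator evalop_commute)
    also have "\<dots> = (\<Sum>r\<le>N. base_const k ^ r * evalop N (base_const d) (D_hat N r f))"
      unfolding evalop_expansion[of N k] base_const_power[symmetric] evalop_sum ..
    finally show "poly (generating_operator N [:evalop N (base_const d) f:]) (base_const k) =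
        poly (\<Sum>r\<le>N. monom (evalop N (base_const d) (D_hat N r f)) r) (base_const k)"
      by (simp add: poly_sum poly_monom mult.commute)
  qed
  then show ?thesis
    using assms unfolding D_hat_def[of N r "evalop N (base_const d) f"] by (simp add: coeff_sum)
qed

text \<open>The second extraction, now in the parameter that \<open>D_hat_evalop\<close> left as a
  constant.\<close>

lemma D_hat_commute:
  assumes "r \<le> N" "s \<le> N"
  shows "D_hat N r (D_hat N s f) = D_hat N s (D_hat N r f)"
proof -
  have "(\<Sum>s\<le>N. monom (D_hat N r (D_hat N s f)) s) = generating_operator N [:D_hat N r f:]"
  proof (rule poly_eqI_base_const)
    fix k
    have "poly (\<Sum>s\<le>N. monom (D_hat N r (D_hat N s f)) s) (base_const k) =
        (\<Sum>s\<le>N. base_const (k ^ s) * D_hat N r (D_hat N s f))"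
      by (simp add: poly_sum poly_monom base_const_power mult.commute)
    also have "\<dots> = D_hat N r (evalop N (base_const k) f)"
      unfolding evalop_expansion base_const_power[symmetric] D_hat_sum ..
    also have "\<dots> = poly (generating_operator N [:D_hat N r f:]) (base_const k)"
      using D_hat_evalop[OF assms(1)] by (simp add: poly_generating_operator)
    finally show "poly (\<Sum>s\<le>N. monom (D_hat N r (D_hat N s f)) s) (base_const k) =
        poly (generating_operator N [:D_hat N r f:]) (base_const k)" .
  qed
  then have "coeff (\<Sum>s\<le>N. monom (D_hat N r (D_hat N s f)) s) s = D_hat N s (D_hat N r f)"
    by (simp add: D_hat_def)
  then show ?thesis
    using assms(2) by (simp add: coeff_sum)
qed

theorem corollary7p6:
  fixes N :: nat
  assumes "1 \<le> N"
  shows "(\<forall>f. generating_operator N [:f:] = [:f:] + (\<Sum>r = 1..N. monom (D_hat N r f) r)) \<and>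
         (\<forall>r\<in>{1..N}. \<forall>s\<in>{1..N}. D_hat N r \<circ> D_hat N s = D_hat N s \<circ> D_hat N r)"
proof (intro conjI allI ballI)
  fix f
  \<comment> \<open>The constant coefficient in \<open>z\<close> is the value at
    \<open>base_const 0\<close>.\<close>
  have "D_hat N 0 f = f"
    using poly_generating_operator[of N f 0] by (simp add: D_hat_def poly_0_coeff_0 evalop_0)
  moreover have "{..N} = insert 0 {1..N}" by auto
  ultimately show "generating_operator N [:f:] = [:f:] + (\<Sum>r = 1..N. monom (D_hat N r f) r)"
    by (simp add: generating_operator_expansion monom_0)
next
  fix r s assume "r \<in> {1..N}" "s \<in> {1..N}"
  then show "D_hat N r \<circ> D_hat N s = D_hat N s \<circ> D_hat N r"
    using D_hat_commute by (simp add: fun_eq_iff)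
qed

end
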